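(* Let $(\mathcal{E},\mathcal{F})$ be a regular Dirichlet form on $L^2(E;m)$. Let $\mu\in\mathcal{S}$ be a smooth measure whose $\alpha$-potential $R_\alpha\mu$ belongs to $L^\infty(E;m)$ for all $\alpha>0$, and let $\{F_\ell\}$ be a (compact) nest attached to $\mu$, that is, $1_{F_\ell}\mu\in\mathcal{S}_0$ for all $\ell\in\mathbb{N}$. Then $\mu$ is a Radon measure.
   Context: Setting: $E$ is a locally compact separable metric space, $m$ a positive Radon measure on $E$ with full topological support, $(\mathcal{E},\mathcal{F})$ a regular symmetric Dirichlet form on $L^2(E;m)$, $\mathcal{E}_1(f,g)=\mathcal{E}(f,g)+\int_E fg\,dm$, and $X=(X_t,\mathbb{P}_x,\zeta)$ the associated $m$-symmetric Hunt process. $C_c$ is the space of continuous functions with compact support. Capacity: for open $A$, $\mathrm{Cap}(A)=\inf\{\mathcal{E}_1(u,u):u\in\mathcal{F},\,u\ge1\ m\text{-a.e. on }A\}$ ($\inf\emptyset=\infty$), and $\mathrm{Cap}(B)=\inf\{\mathrm{Cap}(A):A\supset B\text{ open}\}$ for general $B$. A compact nest is an increasing sequence $\{F_k\}$ of compact sets with $\mathrm{Cap}(K\setminus F_k)\to0$ for every compact $K$. A positive Borel measure $\mu$ on $E$ is smooth if it charges no set of zero capacity and there is a compact nest $\{F_k\}$ with $\mu(F_k)<\infty$ for all $k$. $\mathcal{S}$ is the set of all smooth measures. Each $\mu\in\mathcal{S}$ corresponds uniquely (up to equivalence) to a positive continuous additive functional (PCAF) $A^\mu$ via the Revuz correspondence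 $\mathbb{E}_{hm}[\int_0^\infty e^{-\alpha s}f(X_s)\,dA^\mu_s]=\int_E f\,R_\alpha h\,d\mu$ for all nonnegative Borel $f,h$, where $R_\alpha h(x)=\mathbb{E}_x[\int_0^\infty e^{-\alpha t}h(X_t)dt]$. Put $R_\alpha\mu(x)=\mathbb{E}_x[\int_0^\infty e^{-\alpha t}dA_t^\mu]$. $\mathcal{S}_0$: Radon measures $\nu$ for which there is $C>0$ with $\int|f|d\nu\le C\sqrt{\mathcal{E}_1(f,f)}$ for all $f\in\mathcal{F}\cap C_c$. *)

theory Defs
  imports "HOL-Probability.Probability"
begin

section \<open>Measures and functions on the state space\<close>

text \<open>
  The state space is the whole of a type \<open>'a\<close> of sort
  \<open>{metric_space, second_countable_topology}\<close>; for metric spaces, second countable and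
  separable are the same.  Local compactness is the assumption
  \<open>locally_compact_space euclidean\<close> of the theorem.
\<close>

text \<open>
  Every open subset of a locally compact separable metric space is a countable union of compact
  sets, so a Borel measure that is finite on compact sets is automatically inner and outer regular.
\<close>

definition radon_measure :: "'a::topological_space measure \<Rightarrow> bool" where
  "radon_measure \<mu> \<longleftrightarrow> sets \<mu> = sets borel \<and> (\<forall>K. compact K \<longrightarrow> emeasure \<mu> K < \<infinity>)"

definition full_support :: "'a::topological_space measure \<Rightarrow> bool" where
  "full_support m \<longleftrightarrow> (\<forall>U. open U \<and> U \<noteq> {} \<longrightarrow> emeasure m U > 0)"

definition Cc :: "('a::topological_space \<Rightarrow> real) set" where
  "Cc = {f. continuous_on UNIV f \<and> compact (closure {x. f x \<noteq> 0})}"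

text \<open>
  Elements of \<open>L\<^sup>2\<close> are represented by Borel functions; invariance under change on null sets is
  an explicit requirement on the form below.
\<close>

definition L2 :: "'a measure \<Rightarrow> ('a \<Rightarrow> real) set" where
  "L2 m = {f \<in> borel_measurable m. integrable m (\<lambda>x. (f x)\<^sup>2)}"

section \<open>Dirichlet forms\<close>

definition form1 ::
  "'a measure \<Rightarrow> (('a \<Rightarrow> real) \<Rightarrow> ('a \<Rightarrow> real) \<Rightarrow> real) \<Rightarrow> ('a \<Rightarrow> real) \<Rightarrow> ('a \<Rightarrow> real) \<Rightarrow> real" where
  "form1 m \<E> f g = \<E> f g + (LINT x|m. f x * g x)"

definition symmetric_form ::
  "'a measure \<Rightarrow> (('a \<Rightarrow> real) \<Rightarrow> ('a \<Rightarrow> real) \<Rightarrow> real) \<Rightarrow> ('a \<Rightarrow> real) set \<Rightarrow> bool" where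
  "symmetric_form m \<E> \<F> \<longleftrightarrow>
     \<F> \<subseteq> L2 m \<and> (\<lambda>_. 0) \<in> \<F> \<and>
     (\<forall>f\<in>\<F>. \<forall>g\<in>\<F>. (\<lambda>x. f x + g x) \<in> \<F>) \<and>
     (\<forall>f\<in>\<F>. \<forall>c. (\<lambda>x. c * f x) \<in> \<F>) \<and>
     (\<forall>f\<in>\<F>. \<forall>g\<in>borel_measurable m. (AE x in m. f x = g x) \<longrightarrow>
        g \<in> \<F> \<and> (\<forall>h\<in>\<F>. \<E> f h = \<E> g h)) \<and>
     (\<forall>f\<in>L2 m. \<forall>\<epsilon>>0. \<exists>g\<in>\<F>. (LINT x|m. (f x - g x)\<^sup>2) < \<epsilon>) \<and>
     (\<forall>f\<in>\<F>. \<forall>g\<in>\<F>. \<forall>h\<in>\<F>. \<E> (\<lambda>x. f x + g x) h = \<E> f h + \<E> g h) \<and>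
     (\<forall>f\<in>\<F>. \<forall>g\<in>\<F>. \<forall>c. \<E> (\<lambda>x. c * f x) g = c * \<E> f g) \<and>
     (\<forall>f\<in>\<F>. \<forall>g\<in>\<F>. \<E> f g = \<E> g f) \<and>
     (\<forall>f\<in>\<F>. \<E> f f \<ge> 0)"

definition closed_form ::
  "'a measure \<Rightarrow> (('a \<Rightarrow> real) \<Rightarrow> ('a \<Rightarrow> real) \<Rightarrow> real) \<Rightarrow> ('a \<Rightarrow> real) set \<Rightarrow> bool" where
  "closed_form m \<E> \<F> \<longleftrightarrow>
     (\<forall>u :: nat \<Rightarrow> 'a \<Rightarrow> real.
        (\<forall>n. u n \<in> \<F>) \<and>
        (\<forall>\<epsilon>>0. \<exists>N. \<forall>i\<ge>N. \<forall>j\<ge>N.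
           form1 m \<E> (\<lambda>x. u i x - u j x) (\<lambda>x. u i x - u j x) < \<epsilon>) \<longrightarrow>
        (\<exists>v\<in>\<F>. (\<lambda>n. form1 m \<E> (\<lambda>x. u n x - v x) (\<lambda>x. u n x - v x)) \<longlonglongrightarrow> 0))"

definition dirichlet_form ::
  "'a measure \<Rightarrow> (('a \<Rightarrow> real) \<Rightarrow> ('a \<Rightarrow> real) \<Rightarrow> real) \<Rightarrow> ('a \<Rightarrow> real) set \<Rightarrow> bool" where
  "dirichlet_form m \<E> \<F> \<longleftrightarrow>
     symmetric_form m \<E> \<F> \<and> closed_form m \<E> \<F> \<and>
     (\<forall>u\<in>\<F>. (\<lambda>x. min (max (u x) 0) 1) \<in> \<F> \<and>
        \<E> (\<lambda>x. min (max (u x) 0) 1) (\<lambda>x. min (max (u x) 0) 1) \<le> \<E> u u)"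

definition regular_dirichlet_form ::
  "'a::topological_space measure \<Rightarrow> (('a \<Rightarrow> real) \<Rightarrow> ('a \<Rightarrow> real) \<Rightarrow> real) \<Rightarrow>
   ('a \<Rightarrow> real) set \<Rightarrow> bool" where
  "regular_dirichlet_form m \<E> \<F> \<longleftrightarrow>
     dirichlet_form m \<E> \<F> \<and>
     (\<forall>u\<in>\<F>. \<forall>\<epsilon>>0. \<exists>v\<in>\<F> \<inter> Cc. form1 m \<E> (\<lambda>x. u x - v x) (\<lambda>x. u x - v x) < \<epsilon>) \<and>
     (\<forall>f\<in>Cc. \<forall>\<epsilon>>0. \<exists>v\<in>\<F> \<inter> Cc. \<forall>x. \<bar>f x - v x\<bar> < \<epsilon>)"

section \<open>Capacity, nests and classes of measures\<close>

definition cap_open ::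
  "'a measure \<Rightarrow> (('a \<Rightarrow> real) \<Rightarrow> ('a \<Rightarrow> real) \<Rightarrow> real) \<Rightarrow> ('a \<Rightarrow> real) set \<Rightarrow>
   'a set \<Rightarrow> ennreal" where
  "cap_open m \<E> \<F> A =
     (INF u\<in>{u \<in> \<F>. AE x in m. x \<in> A \<longrightarrow> u x \<ge> 1}. ennreal (form1 m \<E> u u))"

definition cap ::
  "'a::topological_space measure \<Rightarrow> (('a \<Rightarrow> real) \<Rightarrow> ('a \<Rightarrow> real) \<Rightarrow> real) \<Rightarrow>
   ('a \<Rightarrow> real) set \<Rightarrow> 'a set \<Rightarrow> ennreal" where
  "cap m \<E> \<F> B = (INF A\<in>{A. open A \<and> B \<subseteq> A}. cap_open m \<E> \<F> A)"

definition compact_nest ::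
  "'a::topological_space measure \<Rightarrow> (('a \<Rightarrow> real) \<Rightarrow> ('a \<Rightarrow> real) \<Rightarrow> real) \<Rightarrow>
   ('a \<Rightarrow> real) set \<Rightarrow> (nat \<Rightarrow> 'a set) \<Rightarrow> bool" where
  "compact_nest m \<E> \<F> F \<longleftrightarrow>
     incseq F \<and> (\<forall>k. compact (F k)) \<and>
     (\<forall>K. compact K \<longrightarrow> (\<lambda>k. cap m \<E> \<F> (K - F k)) \<longlonglongrightarrow> 0)"

definition smooth_measures ::
  "'a::topological_space measure \<Rightarrow> (('a \<Rightarrow> real) \<Rightarrow> ('a \<Rightarrow> real) \<Rightarrow> real) \<Rightarrow>
   ('a \<Rightarrow> real) set \<Rightarrow> 'a measure set" where
  "smooth_measures m \<E> \<F> =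
     {\<mu>. sets \<mu> = sets borel \<and>
         (\<forall>B\<in>sets borel. cap m \<E> \<F> B = 0 \<longrightarrow> emeasure \<mu> B = 0) \<and>
         (\<exists>F. compact_nest m \<E> \<F> F \<and> (\<forall>k. emeasure \<mu> (F k) < \<infinity>))}"

definition S0_measures ::
  "'a::topological_space measure \<Rightarrow> (('a \<Rightarrow> real) \<Rightarrow> ('a \<Rightarrow> real) \<Rightarrow> real) \<Rightarrow>
   ('a \<Rightarrow> real) set \<Rightarrow> 'a measure set" where
  "S0_measures m \<E> \<F> =
     {\<nu>. radon_measure \<nu> \<and>
         (\<exists>C>0. \<forall>f\<in>\<F> \<inter> Cc. (LINT x|\<nu>. \<bar>f x\<bar>) \<le> C * sqrt (form1 m \<E> f f))}"

text \<open>For a function with values in \<open>[0, \<infinity>]\<close>; the measurability is with respect to the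
  completion because potentials of additive functionals need not be Borel.\<close>

definition in_Linf :: "'a measure \<Rightarrow> ('a \<Rightarrow> ennreal) \<Rightarrow> bool" where
  "in_Linf m f \<longleftrightarrow> f \<in> borel_measurable (completion m) \<and> esssup (completion m) f < \<infinity>"

section \<open>Hunt processes\<close>

text \<open>
  \<open>None\<close> is the cemetery, the point at infinity of the one-point compactification (an isolated
  point if the state space is compact).  Functions on the state space vanish at the cemetery.
\<close>

definition cemetery_topology :: "'a::topological_space option topology" where
  "cemetery_topology = Alexandroff_compactification euclidean"

definition cemetery_borel :: "'a::topological_space option measure" where
  "cemetery_borel = sigma UNIV {U. openin cemetery_topology U}"

definition ext0 :: "('a \<Rightarrow> 'b::zero) \<Rightarrow> 'a option \<Rightarrow> 'b" where
  "ext0 f z = (case z of None \<Rightarrow> 0 | Some x \<Rightarrow> f x)"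

text \<open>
  The components are the sample space, the maps \<open>X\<^sub>t\<close> for \<open>t \<in> [0, \<infinity>]\<close>, the shifts, and the laws
  \<open>P\<^sub>x\<close> for \<open>x\<close> in the state space with cemetery.  The laws live on the sigma-algebra generated by
  the \<open>X\<^sub>t\<close>; sets of its universal completion are measured by \<open>completion\<close>.
\<close>

record ('w, 'a) process =
  outcomes :: "'w set"
  state_at :: "ennreal \<Rightarrow> 'w \<Rightarrow> 'a option"
  time_shift :: "ennreal \<Rightarrow> 'w \<Rightarrow> 'w"
  law_from :: "'a option \<Rightarrow> 'w measure"

definition lifetime :: "('w, 'a) process \<Rightarrow> 'w \<Rightarrow> ennreal" where
  "lifetime X \<omega> = Inf {t. state_at X t \<omega> = None}"

definition natural_filtration ::
  "('w, 'a::topological_space) process \<Rightarrow> ennreal \<Rightarrow> 'w measure" where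
  "natural_filtration X t =
     sigma (outcomes X)
       {state_at X s -` B \<inter> outcomes X | s B. s \<le> t \<and> B \<in> sets cemetery_borel}"

definition initial_laws :: "'a::topological_space option measure set" where
  "initial_laws = space (prob_algebra cemetery_borel)"

definition law_init ::
  "('w, 'a) process \<Rightarrow> 'a option measure \<Rightarrow> 'w measure" where
  "law_init X \<rho> = \<rho> \<bind> law_from X"

text \<open>
  The minimal completed filtration: the intersection over all initial laws \<open>\<rho>\<close> of the
  \<open>\<rho>\<close>-augmentations of the natural filtration.  At \<open>t = \<infinity>\<close> this is the universal completion.
\<close>

definition completed_filtration ::
  "('w, 'a::topological_space) process \<Rightarrow> ennreal \<Rightarrow> 'w measure" where
  "completed_filtration X t =
     sigma (outcomes X)
       {A. A \<subseteq> outcomes X \<and>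
           (\<forall>\<rho>\<in>initial_laws. \<exists>B\<in>sets (natural_filtration X t). \<exists>N\<in>null_sets (law_init X \<rho>).
              (A - B) \<union> (B - A) \<subseteq> N)}"

definition hunt_process :: "('w, 'a::topological_space) process \<Rightarrow> bool" where
  "hunt_process X \<longleftrightarrow>
     \<comment> \<open>Measurability in the starting point, and normality\<close>
     law_from X \<in> cemetery_borel \<rightarrow>\<^sub>M prob_algebra (natural_filtration X \<infinity>) \<and>
     (\<forall>x. AE \<omega> in law_from X x. state_at X 0 \<omega> = x) \<and>
     \<comment> \<open>Paths\<close>
     (\<forall>\<omega>\<in>outcomes X.
        state_at X \<infinity> \<omega> = None \<and>
        (\<forall>t\<ge>lifetime X \<omega>. state_at X t \<omega> = None) \<and>
        (\<forall>t<\<infinity>. time_shift X t \<omega> \<in> outcomes X \<and>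
           (\<forall>s. state_at X s (time_shift X t \<omega>) = state_at X (s + t) \<omega>)) \<and>
        (\<forall>t<\<infinity>. limitin cemetery_topology (\<lambda>s. state_at X s \<omega>) (state_at X t \<omega>) (at_right t)) \<and>
        (\<forall>t. 0 < t \<and> t < \<infinity> \<longrightarrow>
           (\<exists>l. limitin cemetery_topology (\<lambda>s. state_at X s \<omega>) l (at_left t)))) \<and>
     \<comment> \<open>Right continuity of the filtration\<close>
     (\<forall>t<\<infinity>. sets (completed_filtration X t) = (\<Inter>s\<in>{t<..}. sets (completed_filtration X s))) \<and>
     \<comment> \<open>Strong Markov property\<close>
     (\<forall>\<rho>\<in>initial_laws. \<forall>T. stopping_time (completed_filtration X) T \<longrightarrow>
        (\<forall>A\<in>sets (filtration.pre_sigma (outcomes X) (completed_filtration X) T).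
         \<forall>s. \<forall>B\<in>sets cemetery_borel.
           emeasure (completion (law_init X \<rho>)) {\<omega> \<in> A. state_at X (T \<omega> + s) \<omega> \<in> B} =
           (\<integral>\<^sup>+\<omega>\<in>A. emeasure (law_from X (state_at X (T \<omega>) \<omega>)) {\<omega>' \<in> outcomes X. state_at X s \<omega>' \<in> B}
              \<partial>completion (law_init X \<rho>)))) \<and>
     \<comment> \<open>Quasi-left continuity\<close>
     (\<forall>\<rho>\<in>initial_laws. \<forall>(T :: nat \<Rightarrow> 'w \<Rightarrow> ennreal) S.
        (\<forall>n. stopping_time (completed_filtration X) (T n)) \<and>
        stopping_time (completed_filtration X) S \<and>
        (\<forall>\<omega>\<in>outcomes X. incseq (\<lambda>n. T n \<omega>) \<and> (\<lambda>n. T n \<omega>) \<longlonglongrightarrow> S \<omega>) \<longrightarrow>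
        (AE \<omega> in completion (law_init X \<rho>). S \<omega> < \<infinity> \<longrightarrow>
           limitin cemetery_topology (\<lambda>n. state_at X (T n \<omega>) \<omega>) (state_at X (S \<omega>) \<omega>) sequentially))"

text \<open>The transition function, for nonnegative functions and for functions in \<open>L\<^sup>2\<close>.\<close>

definition nn_transition ::
  "('w, 'a) process \<Rightarrow> real \<Rightarrow> ('a \<Rightarrow> ennreal) \<Rightarrow> 'a \<Rightarrow> ennreal" where
  "nn_transition X t f x = (\<integral>\<^sup>+\<omega>. ext0 f (state_at X (ennreal t) \<omega>) \<partial>law_from X (Some x))"

definition transition ::
  "('w, 'a) process \<Rightarrow> real \<Rightarrow> ('a \<Rightarrow> real) \<Rightarrow> 'a \<Rightarrow> real" where
  "transition X t f x = (LINT \<omega>|law_from X (Some x). ext0 f (state_at X (ennreal t) \<omega>))"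

definition symmetric_process :: "'a::topological_space measure \<Rightarrow> ('w, 'a) process \<Rightarrow> bool" where
  "symmetric_process m X \<longleftrightarrow>
     (\<forall>t\<ge>0. \<forall>f\<in>borel_measurable borel. \<forall>g\<in>borel_measurable borel.
        (\<integral>\<^sup>+x. f x * nn_transition X t g x \<partial>m) = (\<integral>\<^sup>+x. nn_transition X t f x * g x \<partial>m))"

text \<open>
  The Dirichlet form of a symmetric process, obtained from its transition semigroup by
  \<open>\<E>(u, v) = lim (1/t) \<langle>u - P\<^sub>t u, v\<rangle>\<close> as \<open>t\<close> tends to \<open>0\<close>, the domain consisting of those \<open>u\<close>
  in \<open>L\<^sup>2\<close> for which \<open>(1/t) \<langle>u - P\<^sub>t u, u\<rangle>\<close> has a finite limit.
\<close>

definition approx_form ::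
  "'a measure \<Rightarrow> ('w, 'a) process \<Rightarrow> real \<Rightarrow> ('a \<Rightarrow> real) \<Rightarrow> ('a \<Rightarrow> real) \<Rightarrow> real" where
  "approx_form m X t u v = (1 / t) * (LINT x|m. (u x - transition X t u x) * v x)"

definition associated ::
  "'a::topological_space measure \<Rightarrow> (('a \<Rightarrow> real) \<Rightarrow> ('a \<Rightarrow> real) \<Rightarrow> real) \<Rightarrow>
   ('a \<Rightarrow> real) set \<Rightarrow> ('w, 'a) process \<Rightarrow> bool" where
  "associated m \<E> \<F> X \<longleftrightarrow>
     symmetric_process m X \<and>
     \<F> = {u \<in> L2 m. \<exists>l. ((\<lambda>t. approx_form m X t u u) \<longlongrightarrow> l) (at_right 0)} \<and>
     (\<forall>u\<in>\<F>. \<forall>v\<in>\<F>. ((\<lambda>t. approx_form m X t u v) \<longlongrightarrow> \<E> u v) (at_right 0))"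

definition resolvent ::
  "('w, 'a) process \<Rightarrow> real \<Rightarrow> ('a \<Rightarrow> ennreal) \<Rightarrow> 'a \<Rightarrow> ennreal" where
  "resolvent X \<alpha> h x =
     (\<integral>\<^sup>+\<omega>. (\<integral>\<^sup>+t\<in>{0..}. ennreal (exp (- \<alpha> * t)) * ext0 h (state_at X (ennreal t) \<omega>) \<partial>lborel)
        \<partial>law_from X (Some x))"

section \<open>Positive continuous additive functionals\<close>

text \<open>
  An additive functional may become infinite at the lifetime, but not before.  The set \<open>D\<close> is
  the defining set and \<open>N\<close> the exceptional set.
\<close>

definition pcaf ::
  "'a::topological_space measure \<Rightarrow> (('a \<Rightarrow> real) \<Rightarrow> ('a \<Rightarrow> real) \<Rightarrow> real) \<Rightarrow>
   ('a \<Rightarrow> real) set \<Rightarrow> ('w, 'a) process \<Rightarrow> (ennreal \<Rightarrow> 'w \<Rightarrow> ennreal) \<Rightarrow> bool" where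
  "pcaf m \<E> \<F> X A \<longleftrightarrow>
     (\<forall>t<\<infinity>. A t \<in> borel_measurable (completed_filtration X t)) \<and>
     (\<exists>D\<in>sets (completed_filtration X \<infinity>). \<exists>N. cap m \<E> \<F> N = 0 \<and>
        (\<forall>x. x \<notin> N \<longrightarrow> emeasure (completion (law_from X (Some x))) D = 1) \<and>
        (\<forall>t. 0 < t \<and> t < \<infinity> \<longrightarrow> time_shift X t ` D \<subseteq> D) \<and>
        (\<forall>\<omega>\<in>D.
           A 0 \<omega> = 0 \<and>
           continuous_on {t. t < \<infinity>} (\<lambda>t. A t \<omega>) \<and>
           (\<forall>t<lifetime X \<omega>. A t \<omega> < \<infinity>) \<and>
           (\<forall>t<\<infinity>. lifetime X \<omega> \<le> t \<longrightarrow> A t \<omega> = A (lifetime X \<omega>) \<omega>) \<and>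
           (\<forall>s<\<infinity>. \<forall>t<\<infinity>. A (t + s) \<omega> = A s \<omega> + A t (time_shift X s \<omega>))))"

text \<open>
  The Stieltjes integral over \<open>[0, \<infinity>)\<close> of \<open>g\<close> against a continuous nondecreasing \<open>a\<close> with
  \<open>a 0 = 0\<close>.  As \<open>a\<close> may reach \<open>\<infinity>\<close>, it is stopped at times \<open>u\<close> at which it is still finite,
  and the supremum over \<open>u\<close> is taken.  Stopping also keeps \<open>a\<close> at \<open>0\<close> on the negative half-line,
  since \<open>ennreal\<close> maps negative numbers to \<open>0\<close>.  For an additive functional nothing is lost: the
  integrand carries no mass from the lifetime on.
\<close>

definition stieltjes_nn_integral ::
  "(ennreal \<Rightarrow> ennreal) \<Rightarrow> (real \<Rightarrow> ennreal) \<Rightarrow> ennreal" where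
  "stieltjes_nn_integral a g =
     (SUP u\<in>{u::real. 0 \<le> u \<and> a (ennreal u) < \<infinity>}.
        \<integral>\<^sup>+s. g s \<partial>interval_measure (\<lambda>t. enn2real (a (ennreal (min t u)))))"

text \<open>\<open>af_potential X A \<alpha> f x\<close> is the expectation under \<open>P\<^sub>x\<close> of
  \<open>\<integral> exp (- \<alpha> s) f (X\<^sub>s) dA\<^sub>s\<close>; for \<open>f = 1\<close> it is the \<open>\<alpha>\<close>-potential of the Revuz measure.\<close>

definition af_potential ::
  "('w, 'a) process \<Rightarrow> (ennreal \<Rightarrow> 'w \<Rightarrow> ennreal) \<Rightarrow> real \<Rightarrow> ('a \<Rightarrow> ennreal) \<Rightarrow> 'a \<Rightarrow> ennreal" where
  "af_potential X A \<alpha> f x =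
     (\<integral>\<^sup>+\<omega>. stieltjes_nn_integral (\<lambda>t. A t \<omega>)
             (\<lambda>s. ennreal (exp (- \<alpha> * s)) * ext0 f (state_at X (ennreal s) \<omega>))
        \<partial>completion (law_from X (Some x)))"

definition revuz_correspondence ::
  "'a::topological_space measure \<Rightarrow> ('w, 'a) process \<Rightarrow> (ennreal \<Rightarrow> 'w \<Rightarrow> ennreal) \<Rightarrow>
   'a measure \<Rightarrow> bool" where
  "revuz_correspondence m X A \<mu> \<longleftrightarrow>
     (\<forall>\<alpha>>0. \<forall>f\<in>borel_measurable borel. \<forall>h\<in>borel_measurable borel.
        (\<integral>\<^sup>+x. h x * af_potential X A \<alpha> f x \<partial>completion m) = (\<integral>\<^sup>+x. f x * resolvent X \<alpha> h x \<partial>\<mu>))"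

end

theory Submission
  imports Defs
begin

text \<open>
  It has to be shown that \<open>\<mu>(K)\<close> is finite for compact \<open>K\<close>.  Let \<open>C\<close> be a bound for \<open>R\<^sub>1 \<mu>\<close>.  The
  proof is the classical estimate \<open>\<nu>(K) \<le> C \<E>\<^sub>1(f, f)\<close> for a measure \<open>\<nu>\<close> on \<open>K\<close> whose \<open>1\<close>-potential
  \<open>V\<close> is at most \<open>C\<close>, where \<open>f\<close> is a function of the domain with \<open>0 \<le> f \<le> 1\<close> and \<open>f = 1\<close> on \<open>K\<close>.
  It is applied to the restrictions of \<open>\<mu>\<close> to \<open>K \<inter> F l\<close>, which are finite measures.  The right-hand
  side does not depend on \<open>l\<close>, and the sets \<open>K \<inter> F l\<close> exhaust \<open>K\<close> up to a set of zero capacity, so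
  the same bound holds for \<open>\<mu>(K)\<close>.

  The estimate itself is a quadratic inequality.  Formally \<open>\<E>\<^sub>1(V, g) = \<nu>(g)\<close>, hence
  \<open>\<E>\<^sub>1(V, V) = \<nu>(V) \<le> C \<nu>(1)\<close> and \<open>\<E>\<^sub>1(V, f) = \<nu>(f) = \<nu>(1)\<close>, and expanding
  \<open>0 \<le> \<E>\<^sub>1(V - C f, V - C f)\<close> gives \<open>2 C \<nu>(1) \<le> C \<nu>(1) + C\<^sup>2 \<E>\<^sub>1(f, f)\<close>.

  Justifying the formal identities in the domain of the form would require quasi-continuous versions,
  since \<open>\<nu>\<close> may be singular to \<open>m\<close>.  The proof therefore replaces \<open>\<E>\<^sub>1(u, v)\<close> by the forms
  \<open>(1/t) \<langle>u - exp (- t) P\<^sub>t u, v\<rangle>\<close>, which are defined on all of \<open>L\<^sup>2\<close>, and lets \<open>t\<close> tend to \<open>0\<close> at the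
  very end.  The Revuz correspondence, taken with integrand \<open>1\<close>, says that \<open>\<mu> R\<^sub>1\<close> has the density \<open>R\<^sub>1 \<mu> \<le> C\<close>, so
  \<open>\<nu> R\<^sub>1\<close> has a density \<open>V \<le> C\<close> (\<open>bounded_potential_density\<close>).  The Markov property gives
  \<open>\<langle>h, V - exp (- t) P\<^sub>t V\<rangle> = \<integral>\<^sub>0\<^sup>t exp (- s) \<nu>(P\<^sub>s h) ds\<close> (\<open>potential_density_split\<close>).  For \<open>h = V\<close> the
  right-hand side is at most \<open>t C \<nu>(1)\<close>; for \<open>h = f\<close> it is \<open>t \<nu>(f)\<close> to first order, because
  \<open>P\<^sub>s f \<rightarrow> f\<close> pointwise by right continuity of the paths.  These facts are combined in
  \<open>bounded_potential_energy_inequality\<close>.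
\<close>

section \<open>Joint measurability of the paths\<close>

lemma space_cemetery_borel [simp]: "space cemetery_borel = UNIV"
  by (simp add: cemetery_borel_def)

lemma Some_image_in_cemetery_borel:
  assumes "B \<in> sets (borel :: 'a::topological_space measure)"
  shows "Some ` B \<in> sets cemetery_borel"
proof -
  have op: "Some ` U \<in> sets cemetery_borel" if "open U" for U :: "'a set"
    using that by (auto simp: cemetery_borel_def cemetery_topology_def)
  have "B \<in> sigma_sets UNIV {U. open U}"
    using assms by (simp add: borel_def)
  then show ?thesis
  proof induction
    case (Basic U)
    then show ?case using op by simp
  next
    case Empty
    then show ?case by simp
  next
    case (Compl B)
    have "Some ` (UNIV - B) = Some ` UNIV - Some ` B"
      by auto
    then show ?case
      using Compl op[OF open_UNIV] by (metis sets.Diff)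
  next
    case (Union B)
    then show ?case by (auto simp: image_UN)
  qed
qed

lemma None_in_cemetery_borel:
  "{None} \<in> sets (cemetery_borel :: 'a::topological_space option measure)"
proof -
  have "{None} = space cemetery_borel - Some ` (UNIV :: 'a set)"
    by (auto simp: notin_range_Some)
  then show ?thesis
    using sets.compl_sets[OF Some_image_in_cemetery_borel[of "UNIV :: 'a set"]] by simp
qed

lemma measurable_Some_cemetery [measurable]:
  "Some \<in> borel \<rightarrow>\<^sub>M (cemetery_borel :: 'a::topological_space option measure)"
  unfolding cemetery_borel_def
proof (rule measurable_measure_of)
  fix V :: "'a option set"
  assume "V \<in> {U. openin cemetery_topology U}"
  then consider U where "open U" "V = Some ` U"
    | C where "closed C" "V = insert None (Some ` (- C))"
    by (auto simp: cemetery_topology_def openin_Alexandroff_compactification Compl_eq_Diff_UNIV)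
  then show "Some -` V \<inter> space borel \<in> sets borel"
  proof cases
    case 1
    then have "Some -` V = U" by auto
    with 1 show ?thesis by simp
  next
    case 2
    then have "Some -` V = - C" by auto
    with 2 show ?thesis by (simp add: open_Compl)
  qed
qed auto

lemma measurable_ext0 [measurable]:
  fixes h :: "'a::topological_space \<Rightarrow> 'b::{zero, topological_space}"
  assumes "h \<in> borel_measurable borel"
  shows "ext0 h \<in> borel_measurable cemetery_borel"
proof (rule measurableI)
  fix B :: "'b set"
  assume "B \<in> sets borel"
  then have 1: "Some ` (h -` B) \<in> sets cemetery_borel"
    using measurable_sets[OF assms, of B] by (intro Some_image_in_cemetery_borel) simp
  note 2 = None_in_cemetery_borel[where 'a='a]
  have 3: "ext0 h -` B = Some ` (h -` B) \<union> (if 0 \<in> B then {None} else {})"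
  proof (rule set_eqI)
    fix z show "z \<in> ext0 h -` B \<longleftrightarrow> z \<in> Some ` (h -` B) \<union> (if 0 \<in> B then {None} else {})"
      by (cases z) (auto simp: ext0_def)
  qed
  show "ext0 h -` B \<inter> space cemetery_borel \<in> sets cemetery_borel"
    using 1 sets.Un[OF 2 1] by (simp add: 3)
qed simp

text \<open>
  The open sets around the cemetery are complements of sets \<open>Some ` K\<close> with \<open>K\<close> closed, so the
  sets \<open>Some ` U\<close> with \<open>U\<close> open already generate the Borel sets.
\<close>

lemma measurable_into_cemeteryI:
  fixes Y :: "'c \<Rightarrow> 'a::topological_space option"
  assumes op: "\<And>U. open U \<Longrightarrow> {\<omega> \<in> space N. Y \<omega> \<in> Some ` U} \<in> sets N"
  shows "Y \<in> N \<rightarrow>\<^sub>M cemetery_borel"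
  unfolding cemetery_borel_def
proof (rule measurable_measure_of)
  fix V :: "'a option set"
  assume "V \<in> {U. openin cemetery_topology U}"
  then consider U where "open U" "V = Some ` U"
    | C where "closed C" "V = insert None (Some ` (- C))"
    by (auto simp: cemetery_topology_def openin_Alexandroff_compactification Compl_eq_Diff_UNIV)
  then show "Y -` V \<inter> space N \<in> sets N"
  proof cases
    case 1
    then have "Y -` V \<inter> space N = {\<omega> \<in> space N. Y \<omega> \<in> Some ` U}" by auto
    with op[OF 1(1)] show ?thesis by simp
  next
    case 2
    have V: "V = - (range Some - Some ` (- C))"
      unfolding 2(2) by (rule set_eqI, case_tac x) auto
    have "Y -` V \<inter> space N =
        space N - ({\<omega> \<in> space N. Y \<omega> \<in> range Some} - {\<omega> \<in> space N. Y \<omega> \<in> Some ` (- C)})"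
      unfolding V by auto
    with op[OF open_UNIV] op[of "- C"] 2(1) show ?thesis
      by (simp only: sets.compl_sets sets.Diff open_Compl)
  qed
qed auto

text \<open>
  For an arbitrary continuous \<open>f\<close> the function \<open>ext0 f\<close> can be discontinuous at the cemetery.  This
  does no harm: a path that has reached the cemetery stays there, and a path in a living state
  \<open>Some x\<close> stays for a while in \<open>Some ` U\<close>, for every neighbourhood \<open>U\<close> of \<open>x\<close>.
\<close>

lemma hunt_path_right_continuous:
  fixes f :: "'a::topological_space \<Rightarrow> real"
  assumes X: "hunt_process X" and \<omega>: "\<omega> \<in> outcomes X" and t: "t < \<infinity>"
    and f: "continuous_on UNIV f"
  shows "((\<lambda>s. ext0 f (state_at X s \<omega>)) \<longlongrightarrow> ext0 f (state_at X t \<omega>)) (at_right t)"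
proof (cases "state_at X t \<omega>")
  case None
  then have "lifetime X \<omega> \<le> t"
    by (auto simp: lifetime_def intro: Inf_lower)
  with X \<omega> have "state_at X s \<omega> = None" if "t < s" for s
    using that unfolding hunt_process_def by (meson less_imp_le order_trans)
  then have "eventually (\<lambda>s. ext0 f (state_at X s \<omega>) = 0) (at_right t)"
    by (auto simp: eventually_at_filter ext0_def)
  with None show ?thesis
    by (simp add: tendsto_eventually ext0_def)
next
  case (Some x)
  have lim: "limitin cemetery_topology (\<lambda>s. state_at X s \<omega>) (Some x) (at_right t)"
    using X \<omega> t unfolding hunt_process_def Some[symmetric] by blast
  show ?thesis
  proof (rule topological_tendstoI)
    fix S :: "real set"
    assume S: "open S" "ext0 f (state_at X t \<omega>) \<in> S"
    have "open (f -` S)"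
      using open_vimage[OF S(1) f] .
    then have "openin cemetery_topology (Some ` (f -` S))"
      by (simp add: cemetery_topology_def)
    moreover have "Some x \<in> Some ` (f -` S)"
      using S(2) Some by (auto simp: ext0_def)
    ultimately have "eventually (\<lambda>s. state_at X s \<omega> \<in> Some ` (f -` S)) (at_right t)"
      using lim unfolding limitin_def by blast
    then show "eventually (\<lambda>s. ext0 f (state_at X s \<omega>) \<in> S) (at_right t)"
      by eventually_elim (auto simp: ext0_def)
  qed
qed

lemma space_natural_filtration [simp]: "space (natural_filtration X t) = outcomes X"
  unfolding natural_filtration_def by (rule space_measure_of) auto

lemma measurable_state_at [measurable]:
  "state_at X s \<in> natural_filtration X \<infinity> \<rightarrow>\<^sub>M cemetery_borel"
proof (rule measurableI)
  fix B :: "'b option set"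
  assume "B \<in> sets cemetery_borel"
  then show "state_at X s -` B \<inter> space (natural_filtration X \<infinity>) \<in> sets (natural_filtration X \<infinity>)"
    unfolding space_natural_filtration
    unfolding natural_filtration_def by (intro in_measure_of) auto
qed simp

text \<open>
  By right continuity, the value at time \<open>s\<close> is the limit of the values at the points
  \<open>(\<lfloor>s (n + 1)\<rfloor> + 1) / (n + 1)\<close>, which lie strictly to the right of \<open>s\<close>.  At stage \<open>n\<close> only
  countably many time points occur, which gives joint measurability.
\<close>

lemma hunt_ext0_state_measurable:
  fixes f :: "'a::metric_space \<Rightarrow> real"
  assumes X: "hunt_process X" and f: "continuous_on UNIV f"
  shows "(\<lambda>(s, \<omega>). ext0 f (state_at X (ennreal s) \<omega>))
           \<in> borel_measurable (borel \<Otimes>\<^sub>M natural_filtration X \<infinity>)"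
proof (rule borel_measurable_LIMSEQ_real)
  let ?M = "borel \<Otimes>\<^sub>M natural_filtration X \<infinity> :: (real \<times> _) measure"
  let ?r = "\<lambda>n s::real. (of_int (\<lfloor>s * real (Suc n)\<rfloor>) + 1) / real (Suc n)"
  have [measurable]: "f \<in> borel_measurable borel"
    using f by (rule borel_measurable_continuous_onI)
  show "(\<lambda>(s, \<omega>). ext0 f (state_at X (ennreal (?r n s)) \<omega>)) \<in> borel_measurable ?M" for n
  proof -
    have "(\<lambda>p. (\<lambda>i q. ext0 f (state_at X (ennreal ((of_int i + 1) / real (Suc n))) (snd q)))
              \<lfloor>fst p * real (Suc n)\<rfloor> p) \<in> borel_measurable ?M"
      by (rule measurable_compose_countable) measurable
    then show ?thesis by (simp add: case_prod_beta')
  qed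
  fix p :: "real \<times> _" assume "p \<in> space ?M"
  then obtain s \<omega> where p: "p = (s, \<omega>)" and \<omega>: "\<omega> \<in> outcomes X"
    by (auto simp: space_pair_measure)
  have gt: "s < ?r n s" for n
    by (simp add: pos_less_divide_eq del: of_nat_Suc)
  have le: "?r n s \<le> s + 1 / real (Suc n)" for n
  proof -
    have "of_int \<lfloor>s * real (Suc n)\<rfloor> + 1 \<le> (s + 1 / real (Suc n)) * real (Suc n)"
      by (simp add: distrib_right del: of_nat_Suc)
    then show ?thesis by (simp add: pos_divide_le_eq del: of_nat_Suc)
  qed
  have r: "(\<lambda>n. ?r n s) \<longlonglongrightarrow> s"
  proof (rule tendsto_sandwich)
    show "\<forall>\<^sub>F n in sequentially. s \<le> ?r n s" using gt by (simp add: less_imp_le)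
    show "\<forall>\<^sub>F n in sequentially. ?r n s \<le> s + 1 / real (Suc n)" using le by simp
    show "(\<lambda>n. s + 1 / real (Suc n)) \<longlonglongrightarrow> s"
      using tendsto_add[OF tendsto_const[of s] LIMSEQ_inverse_real_of_nat]
      by (simp add: inverse_eq_divide)
  qed simp
  \<comment> \<open>Negative times are sent to \<open>0\<close> by \<open>ennreal\<close>, so there the sequence is eventually constant.\<close>
  have "(\<lambda>n. ext0 f (state_at X (ennreal (?r n s)) \<omega>)) \<longlonglongrightarrow> ext0 f (state_at X (ennreal s) \<omega>)"
  proof (cases "s < 0")
    case True
    have "\<forall>\<^sub>F n in sequentially. ?r n s < 0"
      using r True by (rule order_tendstoD(2))
    then have "\<forall>\<^sub>F n in sequentially.
        ext0 f (state_at X (ennreal (?r n s)) \<omega>) = ext0 f (state_at X (ennreal s) \<omega>)"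
      by eventually_elim (use True in \<open>simp add: ennreal_neg\<close>)
    then show ?thesis by (rule tendsto_eventually)
  next
    case False
    have "filterlim (\<lambda>n. ennreal (?r n s)) (at_right (ennreal s)) sequentially"
      unfolding filterlim_at
    proof
      show "(\<lambda>n. ennreal (?r n s)) \<longlonglongrightarrow> ennreal s" using r by (rule tendsto_ennrealI)
      show "\<forall>\<^sub>F n in sequentially. ennreal (?r n s) \<in> {ennreal s<..} \<and> ennreal (?r n s) \<noteq> ennreal s"
        using gt False by (auto simp: ennreal_less_iff intro!: always_eventually less_imp_neq[symmetric])
    qed
    from filterlim_compose[OF hunt_path_right_continuous[OF X \<omega> _ f] this]
    show ?thesis by simp
  qed
  then show "(\<lambda>n. case p of (s, \<omega>) \<Rightarrow> ext0 f (state_at X (ennreal (?r n s)) \<omega>))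
      \<longlonglongrightarrow> (case p of (s, \<omega>) \<Rightarrow> ext0 f (state_at X (ennreal s) \<omega>))"
    by (simp add: p)
qed

lemma hunt_jointly_measurable:
  fixes X :: "('w, 'a::metric_space) process"
  assumes X: "hunt_process X"
  shows "(\<lambda>(s, \<omega>). state_at X (ennreal s) \<omega>)
           \<in> borel \<Otimes>\<^sub>M natural_filtration X \<infinity> \<rightarrow>\<^sub>M cemetery_borel"
proof (rule measurable_into_cemeteryI)
  fix U :: "'a set" assume U: "open U"
  let ?M = "borel \<Otimes>\<^sub>M natural_filtration X \<infinity> :: (real \<times> _) measure"
  \<comment> \<open>The case distinction is needed because the distance to the empty set is \<open>0\<close>.\<close>
  define f where "f x = (if U = UNIV then 1 else infdist x (- U))" for x
  have f: "continuous_on UNIV f"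
    by (cases "U = UNIV") (auto simp: f_def intro!: continuous_intros)
  have pos: "f x > 0 \<longleftrightarrow> x \<in> U" for x
  proof (cases "U = UNIV")
    case False
    then have "infdist x (- U) = 0 \<longleftrightarrow> x \<in> - U"
      using U by (intro in_closed_iff_infdist_zero[symmetric]) auto
    with False infdist_nonneg[of x "- U"] show ?thesis by (auto simp: f_def less_le)
  qed (simp add: f_def)
  have eq: "z \<in> Some ` U \<longleftrightarrow> ext0 f z > 0" for z
    by (cases z) (auto simp: ext0_def pos)
  note [measurable] = hunt_ext0_state_measurable[OF X f]
  have "{p \<in> space ?M. (case p of (s, \<omega>) \<Rightarrow> ext0 f (state_at X (ennreal s) \<omega>)) > 0} \<in> sets ?M"
    by measurable
  then show "{p \<in> space ?M. (case p of (s, \<omega>) \<Rightarrow> state_at X (ennreal s) \<omega>) \<in> Some ` U} \<in> sets ?M"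
    by (simp add: eq case_prod_beta')
qed

section \<open>The Markov semigroup and its resolvent\<close>

lemma
  fixes X :: "('w, 'a::topological_space) process"
  assumes "hunt_process X"
  shows hunt_law_kernel: "law_from X \<in> cemetery_borel \<rightarrow>\<^sub>M subprob_algebra (natural_filtration X \<infinity>)"
    and hunt_law_prob: "prob_space (law_from X z)"
    and hunt_law_sets: "sets (law_from X z) = sets (natural_filtration X \<infinity>)"
    and hunt_law_space: "space (law_from X z) = outcomes X"
proof -
  have *: "law_from X \<in> cemetery_borel \<rightarrow>\<^sub>M prob_algebra (natural_filtration X \<infinity>)"
    using assms by (simp add: hunt_process_def)
  then show "law_from X \<in> cemetery_borel \<rightarrow>\<^sub>M subprob_algebra (natural_filtration X \<infinity>)"
    by (rule measurable_prob_algebraD)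
  have "law_from X z \<in> space (prob_algebra (natural_filtration X \<infinity>))"
    using measurable_space[OF *] by simp
  then show "prob_space (law_from X z)" and s: "sets (law_from X z) = sets (natural_filtration X \<infinity>)"
    by (auto simp: space_prob_algebra)
  show "space (law_from X z) = outcomes X"
    using sets_eq_imp_space_eq[OF s] by simp
qed

lemma hunt_state_measurable_law:
  assumes "hunt_process X"
  shows "state_at X t \<in> law_from X z \<rightarrow>\<^sub>M cemetery_borel"
  using measurable_state_at[of X t] measurable_cong_sets[OF hunt_law_sets[OF assms] refl] by blast

lemma nn_transition_jointly_measurable:
  fixes X :: "('w, 'a::metric_space) process"
  assumes X: "hunt_process X" and h[measurable]: "h \<in> borel_measurable borel"
  shows "(\<lambda>(s, x). nn_transition X s h x) \<in> borel_measurable (borel \<Otimes>\<^sub>M borel)"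
proof -
  note [measurable] = hunt_jointly_measurable[OF X] hunt_law_kernel[OF X]
  have "(\<lambda>p. \<integral>\<^sup>+\<omega>. ext0 h (state_at X (ennreal (fst p)) \<omega>) \<partial>law_from X (Some (snd p)))
      \<in> borel_measurable (borel \<Otimes>\<^sub>M borel)"
  proof (rule nn_integral_measurable_subprob_algebra2)
    show "(\<lambda>p. law_from X (Some (snd p))) \<in>
        (borel :: real measure) \<Otimes>\<^sub>M borel \<rightarrow>\<^sub>M subprob_algebra (natural_filtration X \<infinity>)"
      by measurable
    have "(\<lambda>q. ext0 h ((\<lambda>(s, \<omega>). state_at X (ennreal s) \<omega>) (fst (fst q), snd q)))
        \<in> borel_measurable ((borel \<Otimes>\<^sub>M borel) \<Otimes>\<^sub>M natural_filtration X \<infinity>)"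
      by measurable
    then show "(\<lambda>(p, \<omega>). ext0 h (state_at X (ennreal (fst p)) \<omega>))
        \<in> borel_measurable ((borel \<Otimes>\<^sub>M borel) \<Otimes>\<^sub>M natural_filtration X \<infinity>)"
      by (simp add: case_prod_beta')
  qed
  then show ?thesis by (simp add: nn_transition_def case_prod_beta')
qed

lemma nn_transition_measurable:
  fixes X :: "('w, 'a::metric_space) process"
  assumes "hunt_process X" and "h \<in> borel_measurable borel"
  shows "nn_transition X t h \<in> borel_measurable borel"
  using measurable_Pair2[OF nn_transition_jointly_measurable[OF assms], of t] by simp

text \<open>
  Started at the cemetery, the process has lifetime \<open>0\<close>.  Hence the transition function vanishes
  there for functions extended by \<open>ext0\<close>, which the semigroup property below uses.
\<close>

lemma hunt_cemetery_absorbing: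
  assumes X: "hunt_process X"
  shows "AE \<omega> in law_from X None. state_at X t \<omega> = None"
proof -
  have "AE \<omega> in law_from X None. state_at X 0 \<omega> = None"
    using X by (simp add: hunt_process_def)
  then show ?thesis
  proof (rule AE_mp, intro AE_I2 impI)
    fix \<omega> assume \<omega>: "\<omega> \<in> space (law_from X None)" and "state_at X 0 \<omega> = None"
    then have "lifetime X \<omega> \<le> 0"
      unfolding lifetime_def by (intro Inf_lower) simp
    then show "state_at X t \<omega> = None"
      using X \<omega> unfolding hunt_process_def hunt_law_space[OF X]
      by (meson order_trans zero_le)
  qed
qed

lemma space_completed_filtration [simp]: "space (completed_filtration X t) = outcomes X"
  unfolding completed_filtration_def by (rule space_measure_of) auto

lemma filtration_completed_filtration: "filtration (outcomes X) (completed_filtration X)"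
proof
  fix i j :: ennreal assume "i \<le> j"
  have nat: "sets (natural_filtration X i) \<subseteq> sets (natural_filtration X j)"
    unfolding natural_filtration_def
    apply (subst (1 2) sets_measure_of)
      apply blast
     apply blast
    apply (rule sigma_sets_mono')
    using \<open>i \<le> j\<close> by (blast intro: order_trans)
  show "sets (completed_filtration X i) \<subseteq> sets (completed_filtration X j)"
    unfolding completed_filtration_def
    apply (subst (1 2) sets_measure_of)
      apply blast
     apply blast
    apply (rule sigma_sets_mono')
    using nat by blast
qed simp

text \<open>
  The simple Markov property is the strong Markov property at a constant time, started from a
  point mass.
\<close>

lemma hunt_markov:
  fixes X :: "('w, 'a::metric_space) process"
  assumes X: "hunt_process X" and B: "B \<in> sets cemetery_borel" and s: "s < \<infinity>"
  shows "emeasure (law_from X z) {\<omega> \<in> outcomes X. state_at X (s + t) \<omega> \<in> B} =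
         (\<integral>\<^sup>+\<omega>. emeasure (law_from X (state_at X s \<omega>)) {\<omega>' \<in> outcomes X. state_at X t \<omega>' \<in> B}
            \<partial>law_from X z)"
proof -
  let ?\<rho> = "return cemetery_borel z"
  have law: "law_init X ?\<rho> = law_from X z"
    unfolding law_init_def by (rule bind_return[OF hunt_law_kernel[OF X]]) simp
  have \<rho>: "?\<rho> \<in> initial_laws"
    unfolding initial_laws_def space_prob_algebra by (simp add: prob_space_return)
  have T: "stopping_time (completed_filtration X) (\<lambda>_. s)"
    by (simp add: stopping_time_def)
  have \<Omega>: "outcomes X \<in> sets (filtration.pre_sigma (outcomes X) (completed_filtration X) (\<lambda>_. s))"
    using sets.top[of "filtration.pre_sigma (outcomes X) (completed_filtration X) (\<lambda>_. s)"]
    by (simp add: filtration.space_pre_sigma[OF filtration_completed_filtration])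
  have S: "{\<omega> \<in> outcomes X. state_at X (s + t) \<omega> \<in> B} \<in> sets (law_from X z)"
    using measurable_sets[OF hunt_state_measurable_law[OF X, of "s + t" z] B]
    by (simp add: hunt_law_space[OF X] vimage_def Int_def conj_commute)
  have strong: "emeasure (completion (law_init X \<rho>)) {\<omega> \<in> A. state_at X (T \<omega> + r) \<omega> \<in> B} =
           (\<integral>\<^sup>+\<omega>\<in>A. emeasure (law_from X (state_at X (T \<omega>) \<omega>)) {\<omega>' \<in> outcomes X. state_at X r \<omega>' \<in> B}
              \<partial>completion (law_init X \<rho>))"
    if "\<rho> \<in> initial_laws" "stopping_time (completed_filtration X) T"
      "A \<in> sets (filtration.pre_sigma (outcomes X) (completed_filtration X) T)"
    for \<rho> T A r
    using X that B unfolding hunt_process_def by blast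
  have "emeasure (law_from X z) {\<omega> \<in> outcomes X. state_at X (s + t) \<omega> \<in> B} =
      (\<integral>\<^sup>+\<omega>\<in>outcomes X. emeasure (law_from X (state_at X s \<omega>)) {\<omega>' \<in> outcomes X. state_at X t \<omega>' \<in> B}
         \<partial>law_from X z)"
    using strong[OF \<rho> T \<Omega>, of t] S by (simp add: law nn_integral_completion)
  also have "\<dots> = (\<integral>\<^sup>+\<omega>. emeasure (law_from X (state_at X s \<omega>)) {\<omega>' \<in> outcomes X. state_at X t \<omega>' \<in> B}
         \<partial>law_from X z)"
    by (rule nn_integral_cong) (simp add: hunt_law_space[OF X])
  finally show ?thesis .
qed

lemma nn_transition_semigroup:
  fixes X :: "('w, 'a::metric_space) process"
  assumes X: "hunt_process X" and h[measurable]: "h \<in> borel_measurable borel"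
    and s: "0 \<le> s" and t: "0 \<le> t"
  shows "nn_transition X s (nn_transition X t h) x = nn_transition X (s + t) h x"
proof -
  let ?N = "natural_filtration X \<infinity>" and ?L = "law_from X (Some x)"
  note [measurable] = hunt_law_kernel[OF X] hunt_state_measurable_law[OF X]
  let ?k = "\<lambda>\<omega>. distr (law_from X (state_at X s \<omega>)) cemetery_borel (state_at X t)"
  have k: "?k \<in> ?L \<rightarrow>\<^sub>M subprob_algebra cemetery_borel"
  proof -
    have "(\<lambda>M. distr M cemetery_borel (state_at X t)) \<in> subprob_algebra ?N \<rightarrow>\<^sub>M subprob_algebra cemetery_borel"
      by (rule measurable_distr) measurable
    then show ?thesis
      by measurable
  qed
  have ne: "space ?L \<noteq> {}"
    using hunt_law_prob[OF X] by (rule prob_space.not_empty)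
  have "distr ?L cemetery_borel (state_at X (ennreal s + ennreal t)) = ?L \<bind> ?k"
  proof (rule measure_eqI)
    show "sets (distr ?L cemetery_borel (state_at X (ennreal s + ennreal t))) = sets (?L \<bind> ?k)"
      using sets_bind[OF _ ne, of ?k cemetery_borel] by simp
    fix B assume "B \<in> sets (distr ?L cemetery_borel (state_at X (ennreal s + ennreal t)))"
    then have B: "B \<in> sets cemetery_borel" by simp
    have e: "emeasure (distr (law_from X z) cemetery_borel (state_at X u)) B =
        emeasure (law_from X z) {\<omega> \<in> outcomes X. state_at X u \<omega> \<in> B}" for z u
      by (subst emeasure_distr) (auto simp: B hunt_law_space[OF X] intro!: arg_cong[where f="emeasure _"])
    show "emeasure (distr ?L cemetery_borel (state_at X (ennreal s + ennreal t))) B = emeasure (?L \<bind> ?k) B"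
      unfolding emeasure_bind[OF ne k B] e
      by (rule hunt_markov[OF X B]) simp
  qed
  then have "(\<integral>\<^sup>+z. ext0 h z \<partial>distr ?L cemetery_borel (state_at X (ennreal s + ennreal t))) =
      (\<integral>\<^sup>+\<omega>. \<integral>\<^sup>+z. ext0 h z \<partial>?k \<omega> \<partial>?L)"
    by (simp add: nn_integral_bind[OF _ k])
  moreover have "(\<integral>\<^sup>+z. ext0 h z \<partial>?k \<omega>) = ext0 (nn_transition X t h) (state_at X s \<omega>)" for \<omega>
  proof (cases "state_at X s \<omega>")
    case None
    have "(\<integral>\<^sup>+\<omega>. ext0 h (state_at X t \<omega>) \<partial>law_from X None) = (\<integral>\<^sup>+\<omega>. 0 \<partial>law_from X None)"
      using hunt_cemetery_absorbing[OF X, of t] by (intro nn_integral_cong_AE) (auto simp: ext0_def)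
    with None show ?thesis by (simp add: nn_integral_distr ext0_def[of "nn_transition _ _ _"])
  next
    case (Some y)
    then show ?thesis by (simp add: nn_integral_distr nn_transition_def ext0_def[of "nn_transition _ _ _"])
  qed
  ultimately show ?thesis
    by (simp add: nn_transition_def[of _ _ "nn_transition X t h"] nn_transition_def[of X "s + t"]
        nn_integral_distr ennreal_plus s t)
qed

lemma resolvent_eq_Laplace:
  fixes X :: "('w, 'a::metric_space) process"
  assumes X: "hunt_process X" and h[measurable]: "h \<in> borel_measurable borel"
  shows "resolvent X \<alpha> h x =
    (\<integral>\<^sup>+s\<in>{0..}. ennreal (exp (- \<alpha> * s)) * nn_transition X s h x \<partial>lborel)"
proof -
  let ?L = "law_from X (Some x)"
  note [measurable] = hunt_jointly_measurable[OF X] hunt_state_measurable_law[OF X]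
  have [measurable]: "(\<lambda>(s, \<omega>). state_at X (ennreal s) \<omega>) \<in> borel \<Otimes>\<^sub>M ?L \<rightarrow>\<^sub>M cemetery_borel"
    using hunt_jointly_measurable[OF X]
      measurable_cong_sets[OF sets_pair_measure_cong[OF refl hunt_law_sets[OF X]] refl] by blast
  interpret L: prob_space ?L by (rule hunt_law_prob[OF X])
  interpret pair_sigma_finite lborel ?L
    by unfold_locales
  let ?g = "\<lambda>s \<omega>. ennreal (exp (- \<alpha> * s)) * ext0 h ((\<lambda>(s, \<omega>). state_at X (ennreal s) \<omega>) (s, \<omega>)) * indicator {0..} s"
  have "(\<lambda>(s, \<omega>). ?g s \<omega>) \<in> borel_measurable (lborel \<Otimes>\<^sub>M ?L)"
    by measurable
  from Fubini'[OF this] have "resolvent X \<alpha> h x = (\<integral>\<^sup>+s. \<integral>\<^sup>+\<omega>. ?g s \<omega> \<partial>?L \<partial>lborel)"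
    by (simp add: resolvent_def)
  also have "\<dots> = (\<integral>\<^sup>+s\<in>{0..}. ennreal (exp (- \<alpha> * s)) * nn_transition X s h x \<partial>lborel)"
    by (intro nn_integral_cong) (simp add: nn_transition_def nn_integral_cmult nn_integral_multc)
  finally show ?thesis .
qed

lemma resolvent_measurable:
  fixes X :: "('w, 'a::metric_space) process"
  assumes X: "hunt_process X" and h[measurable]: "h \<in> borel_measurable borel"
  shows "resolvent X \<alpha> h \<in> borel_measurable borel"
proof -
  have [measurable]: "(\<lambda>(s, x). nn_transition X s h x) \<in> borel_measurable (lborel \<Otimes>\<^sub>M borel)"
    using nn_transition_jointly_measurable[OF X h]
      measurable_cong_sets[OF sets_pair_measure_cong[OF sets_lborel refl] refl] by blast
  have "(\<lambda>x. \<integral>\<^sup>+s. ennreal (exp (- \<alpha> * s)) * (\<lambda>(s, x). nn_transition X s h x) (s, x) * indicator {0..} s \<partial>lborel)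
      \<in> borel_measurable borel"
    by measurable
  then show ?thesis
    by (simp add: resolvent_eq_Laplace[OF X h, abs_def])
qed

text \<open>
  The Markov property at time \<open>t\<close>.  Integrating this identity against a measure \<open>\<nu>\<close> expresses
  \<open>V - exp (- \<alpha> t) P\<^sub>t V\<close>, for the potential \<open>V\<close> of \<open>\<nu>\<close>, through \<open>\<nu>\<close> and times before \<open>t\<close> only.
\<close>

lemma resolvent_split:
  fixes X :: "('w, 'a::metric_space) process"
  assumes X: "hunt_process X" and h[measurable]: "h \<in> borel_measurable borel" and t: "0 \<le> t"
  shows "resolvent X \<alpha> h x =
    (\<integral>\<^sup>+s\<in>{0..<t}. ennreal (exp (- \<alpha> * s)) * nn_transition X s h x \<partial>lborel) +
    ennreal (exp (- \<alpha> * t)) * resolvent X \<alpha> (nn_transition X t h) x"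
proof -
  let ?p = "\<lambda>s. ennreal (exp (- \<alpha> * s)) * nn_transition X s h x"
  have [measurable]: "(\<lambda>s. nn_transition X s h x) \<in> borel_measurable borel"
    using measurable_Pair1[OF nn_transition_jointly_measurable[OF X h], of x] by simp
  have "resolvent X \<alpha> h x = (\<integral>\<^sup>+s. ?p s * indicator {0..<t} s + ?p s * indicator {t..} s \<partial>lborel)"
    unfolding resolvent_eq_Laplace[OF X h]
    using t by (intro nn_integral_cong) (auto simp: indicator_def)
  also have "\<dots> = (\<integral>\<^sup>+s\<in>{0..<t}. ?p s \<partial>lborel) + (\<integral>\<^sup>+s\<in>{t..}. ?p s \<partial>lborel)"
    by (subst nn_integral_add) auto
  also have "(\<integral>\<^sup>+s\<in>{t..}. ?p s \<partial>lborel) = (\<integral>\<^sup>+s. ?p (t + s) * indicator {t..} (t + s) \<partial>lborel)"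
    by (subst nn_integral_real_affine[where c=1 and t=t]) auto
  \<comment> \<open>The semigroup property turns the shift of time into an application of \<open>P\<^sub>t\<close>.\<close>
  also have "\<dots> = (\<integral>\<^sup>+s. ennreal (exp (- \<alpha> * t)) *
      (ennreal (exp (- \<alpha> * s)) * nn_transition X s (nn_transition X t h) x * indicator {0..} s) \<partial>lborel)"
  proof (intro nn_integral_cong)
    fix s :: real
    have "exp (- \<alpha> * (t + s)) = exp (- \<alpha> * t) * exp (- \<alpha> * s)"
      by (simp add: exp_add[symmetric] algebra_simps)
    then show "?p (t + s) * indicator {t..} (t + s) = ennreal (exp (- \<alpha> * t)) *
      (ennreal (exp (- \<alpha> * s)) * nn_transition X s (nn_transition X t h) x * indicator {0..} s)"
      using t by (auto simp: indicator_def nn_transition_semigroup[OF X h] ennreal_mult mult.assoc add.commute)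
  qed
  also have "\<dots> = ennreal (exp (- \<alpha> * t)) *
      (\<integral>\<^sup>+s\<in>{0..}. ennreal (exp (- \<alpha> * s)) * nn_transition X s (nn_transition X t h) x \<partial>lborel)"
  proof (rule nn_integral_cmult)
    have "(\<lambda>s. nn_transition X s (nn_transition X t h) x) \<in> borel_measurable borel"
      using measurable_Pair1[OF nn_transition_jointly_measurable[OF X nn_transition_measurable[OF X h]], of x] by simp
    then show "(\<lambda>s. ennreal (exp (- \<alpha> * s)) * nn_transition X s (nn_transition X t h) x * indicator {0..} s)
        \<in> borel_measurable lborel"
      by measurable
  qed
  finally show ?thesis
    by (simp add: resolvent_eq_Laplace[OF X nn_transition_measurable[OF X h]])
qed

section \<open>Symmetry and the approximating forms\<close>

lemma nn_transition_le_const: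
  assumes X: "hunt_process X" and h: "\<And>x. h x \<le> c"
  shows "nn_transition X t h x \<le> c"
proof -
  interpret prob_space "law_from X (Some x)" by (rule hunt_law_prob[OF X])
  have "nn_transition X t h x \<le> (\<integral>\<^sup>+\<omega>. c \<partial>law_from X (Some x))"
    unfolding nn_transition_def
    by (intro nn_integral_mono) (auto simp: ext0_def h split: option.split)
  then show ?thesis by (simp add: emeasure_space_1)
qed

lemma ext0_bounded:
  assumes "\<And>x. \<bar>u x\<bar> \<le> (c::real)"
  shows "\<bar>ext0 u z\<bar> \<le> c"
  using order_trans[OF abs_ge_zero assms] assms by (auto simp: ext0_def split: option.split)

lemma integrable_ext0_state:
  fixes u :: "'a::topological_space \<Rightarrow> real"
  assumes X: "hunt_process X" and [measurable]: "u \<in> borel_measurable borel"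
    and c: "\<And>x. \<bar>u x\<bar> \<le> c"
  shows "integrable (law_from X z) (\<lambda>\<omega>. ext0 u (state_at X t \<omega>))"
proof -
  interpret prob_space "law_from X z" by (rule hunt_law_prob[OF X])
  note [measurable] = hunt_state_measurable_law[OF X]
  show ?thesis
    by (rule integrable_const_bound[where B=c]) (auto simp: ext0_bounded[OF c])
qed

lemma ennreal_transition:
  fixes u :: "'a::topological_space \<Rightarrow> real"
  assumes X: "hunt_process X" and u[measurable]: "u \<in> borel_measurable borel"
    and c: "\<And>x. u x \<le> c" and nn: "\<And>x. 0 \<le> u x"
  shows "ennreal (transition X t u x) = nn_transition X t (\<lambda>x. ennreal (u x)) x"
proof -
  have "ennreal (transition X t u x) = (\<integral>\<^sup>+\<omega>. ennreal (ext0 u (state_at X t \<omega>)) \<partial>law_from X (Some x))"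
    unfolding transition_def
  proof (rule nn_integral_eq_integral[symmetric])
    show "integrable (law_from X (Some x)) (\<lambda>\<omega>. ext0 u (state_at X t \<omega>))"
      using c nn by (intro integrable_ext0_state[OF X u, where c=c]) (simp add: abs_of_nonneg)
    show "AE \<omega> in law_from X (Some x). 0 \<le> ext0 u (state_at X t \<omega>)"
      using nn by (intro AE_I2) (simp add: ext0_def split: option.split)
  qed
  also have "\<dots> = nn_transition X t (\<lambda>x. ennreal (u x)) x"
    unfolding nn_transition_def by (intro nn_integral_cong) (simp add: ext0_def split: option.split)
  finally show ?thesis .
qed

lemma transition_nonneg:
  assumes "\<And>x. 0 \<le> u x"
  shows "0 \<le> transition X t u x"
  unfolding transition_def using assms
  by (intro integral_nonneg_AE AE_I2) (simp add: ext0_def split: option.split)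

lemma transition_measurable:
  fixes X :: "('w, 'a::metric_space) process"
  assumes X: "hunt_process X" and u[measurable]: "u \<in> borel_measurable borel"
  shows "transition X t u \<in> borel_measurable borel"
proof -
  note [measurable] = hunt_law_kernel[OF X]
  have "(\<lambda>M. \<integral>\<omega>. ext0 u (state_at X t \<omega>) \<partial>M) \<in> borel_measurable (subprob_algebra (natural_filtration X \<infinity>))"
    by (rule integral_measurable_subprob_algebra) measurable
  then have "(\<lambda>x. \<integral>\<omega>. ext0 u (state_at X t \<omega>) \<partial>law_from X (Some x)) \<in> borel_measurable borel"
    by measurable
  then show ?thesis by (simp add: transition_def[abs_def])
qed

lemma transition_diff_scale:
  fixes u v :: "'a::topological_space \<Rightarrow> real"
  assumes X: "hunt_process X"
    and u: "u \<in> borel_measurable borel" "\<And>x. \<bar>u x\<bar> \<le> c"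
    and v: "v \<in> borel_measurable borel" "\<And>x. \<bar>v x\<bar> \<le> d"
  shows "transition X t (\<lambda>y. u y - a * v y) x = transition X t u x - a * transition X t v x"
proof -
  have "transition X t (\<lambda>y. u y - a * v y) x =
      (\<integral>\<omega>. ext0 u (state_at X t \<omega>) - a * ext0 v (state_at X t \<omega>) \<partial>law_from X (Some x))"
    unfolding transition_def
    by (intro Bochner_Integration.integral_cong) (auto simp: ext0_def split: option.split)
  also have "\<dots> = transition X t u x - a * transition X t v x"
    unfolding transition_def
    using integrable_ext0_state[OF X u] integrable_ext0_state[OF X v] by simp
  finally show ?thesis .
qed

lemma transition_square_le:
  fixes u :: "'a::topological_space \<Rightarrow> real"
  assumes X: "hunt_process X" and u[measurable]: "u \<in> borel_measurable borel" and c: "\<And>x. \<bar>u x\<bar> \<le> c"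
  shows "(transition X t u x)\<^sup>2 \<le> transition X t (\<lambda>y. (u y)\<^sup>2) x"
proof -
  interpret prob_space "law_from X (Some x)" by (rule hunt_law_prob[OF X])
  let ?Y = "\<lambda>\<omega>. ext0 u (state_at X t \<omega>)"
  have sq: "ext0 (\<lambda>y. (u y)\<^sup>2) z = (ext0 u z)\<^sup>2" for z
    by (simp add: ext0_def split: option.split)
  have "\<bar>(u y)\<^sup>2\<bar> \<le> c\<^sup>2" for y
    using c[of y] by (simp add: abs_le_square_iff[symmetric])
  then have i2: "integrable (law_from X (Some x)) (\<lambda>\<omega>. (?Y \<omega>)\<^sup>2)"
    using integrable_ext0_state[OF X, of "\<lambda>y. (u y)\<^sup>2" "c\<^sup>2"] by (simp add: sq)
  have "0 \<le> variance ?Y"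
    by (rule variance_positive)
  also have "variance ?Y = expectation (\<lambda>\<omega>. (?Y \<omega>)\<^sup>2) - (expectation ?Y)\<^sup>2"
    by (rule variance_eq[OF integrable_ext0_state[OF X u c] i2])
  finally show ?thesis
    by (simp add: transition_def sq)
qed

text \<open>
  Jensen's inequality \<open>(P\<^sub>t u)\<^sup>2 \<le> P\<^sub>t (u\<^sup>2)\<close>, followed by symmetry to move \<open>P\<^sub>t\<close> onto the constant
  \<open>1\<close>, where \<open>P\<^sub>t 1 \<le> 1\<close>.
\<close>

lemma transition_L2_contraction:
  fixes X :: "('w, 'a::metric_space) process"
  assumes X: "hunt_process X" and sym: "symmetric_process m X" and m: "sets m = sets borel"
    and t: "0 \<le> t"
    and u[measurable]: "u \<in> borel_measurable borel" and c: "\<And>x. \<bar>u x\<bar> \<le> c"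
    and i: "integrable m (\<lambda>x. (u x)\<^sup>2)"
  shows transition_square_integrable: "integrable m (\<lambda>x. (transition X t u x)\<^sup>2)"
    and "(LINT x|m. (transition X t u x)\<^sup>2) \<le> (LINT x|m. (u x)\<^sup>2)"
proof -
  have [measurable]: "transition X t u \<in> borel_measurable m" "u \<in> borel_measurable m"
    using transition_measurable[OF X u] u by (simp_all add: measurable_cong_sets[OF m refl])
  have b: "(u y)\<^sup>2 \<le> c\<^sup>2" for y
    using c[of y] by (simp add: abs_le_square_iff[symmetric])
  have "(\<integral>\<^sup>+x. ennreal ((transition X t u x)\<^sup>2) \<partial>m)
      \<le> (\<integral>\<^sup>+x. ennreal (transition X t (\<lambda>y. (u y)\<^sup>2) x) \<partial>m)"
    by (intro nn_integral_mono ennreal_leI transition_square_le[OF X u c])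
  also have "\<dots> = (\<integral>\<^sup>+x. 1 * nn_transition X t (\<lambda>y. ennreal ((u y)\<^sup>2)) x \<partial>m)"
    by (intro nn_integral_cong) (simp add: ennreal_transition[OF X _ b])
  also have "\<dots> = (\<integral>\<^sup>+x. nn_transition X t (\<lambda>_. 1) x * ennreal ((u x)\<^sup>2) \<partial>m)"
    using sym[unfolded symmetric_process_def, rule_format, OF t, of "\<lambda>_. 1" "\<lambda>y. ennreal ((u y)\<^sup>2)"]
    by simp
  also have "\<dots> \<le> (\<integral>\<^sup>+x. 1 * ennreal ((u x)\<^sup>2) \<partial>m)"
    by (intro nn_integral_mono mult_right_mono nn_transition_le_const[OF X]) auto
  finally have le: "(\<integral>\<^sup>+x. ennreal ((transition X t u x)\<^sup>2) \<partial>m) \<le> (\<integral>\<^sup>+x. ennreal ((u x)\<^sup>2) \<partial>m)"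
    by simp
  also have eq: "\<dots> = ennreal (LINT x|m. (u x)\<^sup>2)"
    by (rule nn_integral_eq_integral[OF i]) simp
  finally have fin: "(\<integral>\<^sup>+x. ennreal ((transition X t u x)\<^sup>2) \<partial>m) < \<infinity>"
    by (rule le_less_trans) simp
  then show i2: "integrable m (\<lambda>x. (transition X t u x)\<^sup>2)"
    by (intro integrableI_nonneg) auto
  have "ennreal (LINT x|m. (transition X t u x)\<^sup>2) \<le> ennreal (LINT x|m. (u x)\<^sup>2)"
    using le unfolding eq nn_integral_eq_integral[OF i2 AE_I2[OF zero_le_power2]] .
  then show "(LINT x|m. (transition X t u x)\<^sup>2) \<le> (LINT x|m. (u x)\<^sup>2)"
    by (subst (asm) ennreal_le_iff) (auto intro: integral_nonneg_AE)
qed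

lemma integrable_mult_square_integrable:
  fixes u v :: "'a \<Rightarrow> real"
  assumes [measurable]: "u \<in> borel_measurable m" "v \<in> borel_measurable m"
    and "integrable m (\<lambda>x. (u x)\<^sup>2)" "integrable m (\<lambda>x. (v x)\<^sup>2)"
  shows "integrable m (\<lambda>x. u x * v x)"
proof (rule Bochner_Integration.integrable_bound)
  show "integrable m (\<lambda>x. (u x)\<^sup>2 + (v x)\<^sup>2)" using assms by simp
  show "AE x in m. norm (u x * v x) \<le> norm ((u x)\<^sup>2 + (v x)\<^sup>2)"
  proof (intro AE_I2)
    fix x
    have "0 \<le> (\<bar>u x\<bar> - \<bar>v x\<bar>)\<^sup>2" by simp
    then have "2 * (\<bar>u x\<bar> * \<bar>v x\<bar>) \<le> (u x)\<^sup>2 + (v x)\<^sup>2"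
      by (simp add: power2_diff mult.assoc)
    moreover have "0 \<le> \<bar>u x\<bar> * \<bar>v x\<bar>" by simp
    ultimately show "norm (u x * v x) \<le> norm ((u x)\<^sup>2 + (v x)\<^sup>2)"
      unfolding real_norm_def abs_mult by linarith
  qed
qed measurable

lemma transition_integrable_mult:
  fixes X :: "('w, 'a::metric_space) process"
  assumes X: "hunt_process X" and sym: "symmetric_process m X" and m: "sets m = sets borel"
    and t: "0 \<le> t"
    and u: "u \<in> borel_measurable borel" "\<And>x. \<bar>u x\<bar> \<le> c" "integrable m (\<lambda>x. (u x)\<^sup>2)"
    and v: "v \<in> borel_measurable borel" "integrable m (\<lambda>x. (v x)\<^sup>2)"
  shows "integrable m (\<lambda>x. v x * transition X t u x)"
proof (rule integrable_mult_square_integrable)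
  show "v \<in> borel_measurable m" "transition X t u \<in> borel_measurable m"
    using transition_measurable[OF X u(1), of t] v(1) by (simp_all add: measurable_cong_sets[OF m refl])
qed (rule v(2) transition_square_integrable[OF X sym m t u])+

lemma transition_form_le:
  fixes X :: "('w, 'a::metric_space) process"
  assumes X: "hunt_process X" and sym: "symmetric_process m X" and m: "sets m = sets borel"
    and t: "0 \<le> t"
    and u: "u \<in> borel_measurable borel" "\<And>x. \<bar>u x\<bar> \<le> c" "integrable m (\<lambda>x. (u x)\<^sup>2)"
  shows "(LINT x|m. u x * transition X t u x) \<le> (LINT x|m. (u x)\<^sup>2)"
proof -
  note i = transition_square_integrable[OF X sym m t u]
  have "2 * (LINT x|m. u x * transition X t u x) = (LINT x|m. 2 * (u x * transition X t u x))"
    by simp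
  also have "\<dots> \<le> (LINT x|m. (u x)\<^sup>2 + (transition X t u x)\<^sup>2)"
  proof (rule integral_mono)
    show "integrable m (\<lambda>x. 2 * (u x * transition X t u x))"
      using transition_integrable_mult[OF X sym m t u u(1,3)] by simp
    show "2 * (u x * transition X t u x) \<le> (u x)\<^sup>2 + (transition X t u x)\<^sup>2" for x
      using sum_squares_bound[of "u x" "transition X t u x"] by (simp add: mult.assoc)
  qed (use u i in simp)
  also have "\<dots> = (LINT x|m. (u x)\<^sup>2) + (LINT x|m. (transition X t u x)\<^sup>2)"
    using u i by simp
  also have "\<dots> \<le> (LINT x|m. (u x)\<^sup>2) + (LINT x|m. (u x)\<^sup>2)"
    using transition_L2_contraction(2)[OF X sym m t u] by simp
  finally show ?thesis by simp
qed

lemma transition_symmetric_real: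
  fixes X :: "('w, 'a::metric_space) process"
  assumes X: "hunt_process X" and sym: "symmetric_process m X" and m: "sets m = sets borel"
    and t: "0 \<le> t"
    and u: "u \<in> borel_measurable borel" "\<And>x. 0 \<le> u x" "\<And>x. u x \<le> c"
    and v: "v \<in> borel_measurable borel" "\<And>x. 0 \<le> v x" "\<And>x. v x \<le> d"
  shows "(LINT x|m. u x * transition X t v x) = (LINT x|m. v x * transition X t u x)"
proof -
  have [measurable]: "u \<in> borel_measurable m" "v \<in> borel_measurable m"
    "transition X t u \<in> borel_measurable m" "transition X t v \<in> borel_measurable m"
    using transition_measurable[OF X u(1), of t] transition_measurable[OF X v(1), of t] u v
    by (simp_all add: measurable_cong_sets[OF m refl])
  have eu: "(\<lambda>x. ennreal (u x)) \<in> borel_measurable borel" "(\<lambda>x. ennreal (v x)) \<in> borel_measurable borel"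
    using u v by measurable
  have "(\<integral>\<^sup>+x. ennreal (u x * transition X t v x) \<partial>m) = (\<integral>\<^sup>+x. ennreal (u x) * nn_transition X t (\<lambda>x. ennreal (v x)) x \<partial>m)"
    by (intro nn_integral_cong) (simp add: ennreal_mult u transition_nonneg[OF v(2)] ennreal_transition[OF X v(1,3,2)])
  also have "\<dots> = (\<integral>\<^sup>+x. nn_transition X t (\<lambda>x. ennreal (u x)) x * ennreal (v x) \<partial>m)"
    using sym[unfolded symmetric_process_def, rule_format, OF t eu] .
  also have "\<dots> = (\<integral>\<^sup>+x. ennreal (v x * transition X t u x) \<partial>m)"
    by (intro nn_integral_cong)
      (simp add: ennreal_mult v transition_nonneg[OF u(2)] ennreal_transition[OF X u(1,3,2)] mult.commute)
  finally show ?thesis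
    by (subst (1 2) integral_eq_nn_integral)
      (auto intro!: AE_I2 mult_nonneg_nonneg transition_nonneg u v)
qed

text \<open>
  The bilinear form \<open>b(u, v) = \<langle>u, v\<rangle> - exp (- t) \<langle>u, P\<^sub>t v\<rangle>\<close> is symmetric and nonnegative;
  divided by \<open>t\<close> it approximates \<open>\<E>\<^sub>1\<close>.  The inequality is \<open>0 \<le> b(u - a v, u - a v)\<close>, expanded.
\<close>

lemma discounted_form_nonneg_on_difference:
  fixes X :: "('w, 'a::metric_space) process"
  assumes X: "hunt_process X" and sym: "symmetric_process m X" and m: "sets m = sets borel"
    and t: "0 \<le> t"
    and u: "u \<in> borel_measurable borel" "\<And>x. 0 \<le> u x" "\<And>x. u x \<le> c" "integrable m (\<lambda>x. (u x)\<^sup>2)"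
    and v: "v \<in> borel_measurable borel" "\<And>x. 0 \<le> v x" "\<And>x. v x \<le> d" "integrable m (\<lambda>x. (v x)\<^sup>2)"
  shows "2 * a * ((LINT x|m. v x * u x) - exp (- t) * (LINT x|m. u x * transition X t v x))
    \<le> ((LINT x|m. (u x)\<^sup>2) - exp (- t) * (LINT x|m. u x * transition X t u x))
      + a\<^sup>2 * ((LINT x|m. (v x)\<^sup>2) - exp (- t) * (LINT x|m. v x * transition X t v x))"
proof -
  let ?w = "\<lambda>x. u x - a * v x" and ?T = "transition X t"
  have ub: "\<bar>u x\<bar> \<le> c" and vb: "\<bar>v x\<bar> \<le> d" for x
    using u v by (simp_all add: abs_of_nonneg)
  have um: "u \<in> borel_measurable m" and vm: "v \<in> borel_measurable m"
    using u v by (simp_all add: measurable_cong_sets[OF m refl])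
  note uv = integrable_mult_square_integrable[OF vm um v(4) u(4)]
  have w2: "(?w x)\<^sup>2 = (u x)\<^sup>2 - 2 * a * (v x * u x) + a\<^sup>2 * (v x)\<^sup>2" for x
    by (simp add: power2_eq_square algebra_simps)
  have wm: "?w \<in> borel_measurable borel" using u v by measurable
  have wb: "\<bar>?w x\<bar> \<le> c + \<bar>a\<bar> * d" for x
  proof -
    have "\<bar>?w x\<bar> \<le> \<bar>u x\<bar> + \<bar>a\<bar> * \<bar>v x\<bar>" by (simp add: abs_mult[symmetric] abs_triangle_ineq4)
    also have "\<dots> \<le> c + \<bar>a\<bar> * d" by (intro add_mono ub mult_left_mono vb) auto
    finally show ?thesis .
  qed
  have wi: "integrable m (\<lambda>x. (?w x)\<^sup>2)"
    unfolding w2 using u v uv by simp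
  have Iw2: "(LINT x|m. (?w x)\<^sup>2) = (LINT x|m. (u x)\<^sup>2) - 2 * a * (LINT x|m. v x * u x) + a\<^sup>2 * (LINT x|m. (v x)\<^sup>2)"
    unfolding w2 using u v uv by simp
  have iuu: "integrable m (\<lambda>x. u x * ?T u x)" and iuv: "integrable m (\<lambda>x. u x * ?T v x)"
    and ivu: "integrable m (\<lambda>x. v x * ?T u x)" and ivv: "integrable m (\<lambda>x. v x * ?T v x)"
    by (rule transition_integrable_mult[OF X sym m t u(1) ub u(4) u(1,4)]
      transition_integrable_mult[OF X sym m t u(1) ub u(4) v(1,4)]
      transition_integrable_mult[OF X sym m t v(1) vb v(4) u(1,4)]
      transition_integrable_mult[OF X sym m t v(1) vb v(4) v(1,4)])+
  have wT: "?w x * ?T ?w x = u x * ?T u x - a * (u x * ?T v x) - a * (v x * ?T u x) + a\<^sup>2 * (v x * ?T v x)" for x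
    unfolding transition_diff_scale[OF X u(1) ub v(1) vb]
    by (simp add: power2_eq_square algebra_simps)
  have IwT: "(LINT x|m. ?w x * ?T ?w x) = (LINT x|m. u x * ?T u x) - 2 * a * (LINT x|m. u x * ?T v x)
      + a\<^sup>2 * (LINT x|m. v x * ?T v x)"
    unfolding wT using iuu iuv ivu ivv transition_symmetric_real[OF X sym m t v(1-3) u(1-3)] by simp
  have "exp (- t) * (LINT x|m. ?w x * ?T ?w x) \<le> exp (- t) * (LINT x|m. (?w x)\<^sup>2)"
    by (intro mult_left_mono transition_form_le[OF X sym m t wm wb wi]) simp
  also have "\<dots> \<le> 1 * (LINT x|m. (?w x)\<^sup>2)"
    using t by (intro mult_right_mono) auto
  finally show ?thesis
    unfolding Iw2 IwT by (simp add: algebra_simps)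
qed

section \<open>Small times, and potentials as densities\<close>

lemma transition_tendsto_at_0:
  fixes f :: "'a::topological_space \<Rightarrow> real"
  assumes X: "hunt_process X" and f: "continuous_on UNIV f" and c: "\<And>x. \<bar>f x\<bar> \<le> c"
  shows "((\<lambda>s. transition X s f x) \<longlongrightarrow> f x) (at_right 0)"
proof (rule tendsto_at_right_sequentially[of 0 1])
  interpret prob_space "law_from X (Some x)" by (rule hunt_law_prob[OF X])
  note [measurable] = hunt_state_measurable_law[OF X] borel_measurable_continuous_onI[OF f]
  fix S :: "nat \<Rightarrow> real" assume S: "\<And>n. 0 < S n" "S \<longlonglongrightarrow> 0"
  have "(\<lambda>n. expectation (\<lambda>\<omega>. ext0 f (state_at X (S n) \<omega>))) \<longlonglongrightarrow> expectation (\<lambda>\<omega>. ext0 f (state_at X 0 \<omega>))"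
  proof (rule integral_dominated_convergence[where w="\<lambda>_. c"])
    have "filterlim (\<lambda>n. ennreal (S n)) (at_right 0) sequentially"
      unfolding filterlim_at
    proof
      show "(\<lambda>n. ennreal (S n)) \<longlonglongrightarrow> 0" using tendsto_ennrealI[OF S(2)] by simp
      show "\<forall>\<^sub>F n in sequentially. ennreal (S n) \<in> {0<..} \<and> ennreal (S n) \<noteq> 0"
        using S(1) by (auto simp: less_le[symmetric] intro!: always_eventually less_imp_neq[symmetric])
    qed
    from filterlim_compose[OF hunt_path_right_continuous[OF X _ _ f] this]
    show "AE \<omega> in law_from X (Some x). (\<lambda>n. ext0 f (state_at X (S n) \<omega>)) \<longlonglongrightarrow> ext0 f (state_at X 0 \<omega>)"
      by (intro AE_I2) (simp add: hunt_law_space[OF X])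
  qed (auto simp: ext0_bounded[OF c])
  also have "expectation (\<lambda>\<omega>. ext0 f (state_at X 0 \<omega>)) = expectation (\<lambda>\<omega>. f x)"
  proof (rule integral_cong_AE)
    have "AE \<omega> in law_from X (Some x). state_at X 0 \<omega> = Some x"
      using X by (simp add: hunt_process_def)
    then show "AE \<omega> in law_from X (Some x). ext0 f (state_at X 0 \<omega>) = f x"
      by eventually_elim (simp add: ext0_def)
  qed auto
  finally show "(\<lambda>n. transition X (S n) f x) \<longlonglongrightarrow> f x"
    by (simp add: transition_def prob_space)
qed simp

text \<open>
  This is where a measure that may be singular to \<open>m\<close> is tested against \<open>P\<^sub>s f\<close>.  For continuous \<open>f\<close>
  the convergence \<open>P\<^sub>s f \<rightarrow> f\<close> holds at every point, by right continuity of the paths, and not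
  merely almost everywhere with respect to \<open>m\<close>.
\<close>

lemma transition_integral_tendsto_at_0:
  fixes f :: "'a::metric_space \<Rightarrow> real"
  assumes X: "hunt_process X" and \<nu>: "finite_measure \<nu>" "sets \<nu> = sets borel"
    and f: "continuous_on UNIV f" and c: "\<And>x. 0 \<le> f x" "\<And>x. f x \<le> c"
  shows "((\<lambda>s. LINT x|\<nu>. transition X s f x) \<longlongrightarrow> (LINT x|\<nu>. f x)) (at_right 0)"
proof (rule tendsto_at_right_sequentially[of 0 1])
  interpret finite_measure \<nu> by fact
  have fb: "\<bar>f x\<bar> \<le> c" for x using c by (simp add: abs_of_nonneg)
  have fm: "f \<in> borel_measurable borel" using f by (rule borel_measurable_continuous_onI)
  fix S :: "nat \<Rightarrow> real" assume S: "\<And>n. 0 < S n" "S \<longlonglongrightarrow> 0"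
  show "(\<lambda>n. LINT x|\<nu>. transition X (S n) f x) \<longlonglongrightarrow> (LINT x|\<nu>. f x)"
  proof (rule integral_dominated_convergence[where w="\<lambda>_. c"])
    show "f \<in> borel_measurable \<nu>" "\<And>n. transition X (S n) f \<in> borel_measurable \<nu>"
      using fm transition_measurable[OF X fm] by (simp_all add: measurable_cong_sets[OF \<nu>(2) refl])
    have "filterlim S (at_right 0) sequentially"
      using S unfolding filterlim_at by (auto intro!: always_eventually simp: less_imp_neq[symmetric])
    from filterlim_compose[OF transition_tendsto_at_0[OF X f fb] this]
    show "AE x in \<nu>. (\<lambda>n. transition X (S n) f x) \<longlonglongrightarrow> f x"
      by simp
    fix n
    have "ennreal (transition X (S n) f x) \<le> ennreal c" for x
      unfolding ennreal_transition[OF X fm c(2,1)]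
      by (intro nn_transition_le_const[OF X] ennreal_leI c)
    then have "transition X (S n) f x \<le> c" for x
      using order_trans[OF c] by (simp add: ennreal_le_iff)
    then show "AE x in \<nu>. norm (transition X (S n) f x) \<le> c"
      by (simp add: transition_nonneg[OF c(1)])
  qed auto
qed simp

lemma resolvent_1_le:
  fixes X :: "('w, 'a::metric_space) process"
  assumes X: "hunt_process X"
  shows "resolvent X 1 (\<lambda>_. 1) x \<le> 1"
proof -
  have "resolvent X 1 (\<lambda>_. 1) x \<le> (\<integral>\<^sup>+s\<in>{0..}. ennreal (exp (- 1 * s)) * 1 \<partial>lborel)"
    unfolding resolvent_eq_Laplace[OF X borel_measurable_const]
    by (intro nn_integral_mono mult_right_mono mult_left_mono nn_transition_le_const[OF X]) auto
  also have "\<dots> = (\<integral>\<^sup>+s. ennreal (exponential_density 1 s) \<partial>lborel)"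
    by (intro nn_integral_cong) (auto simp: exponential_density_def indicator_def)
  also have "\<dots> = emeasure (density lborel (exponential_density 1)) UNIV"
    by (simp add: emeasure_density)
  also have "\<dots> = 1"
    using prob_space.emeasure_space_1[OF prob_space_exponential_density[of 1]] by simp
  finally show ?thesis .
qed

text \<open>
  The kernel is the image of the product of \<open>exp (- \<alpha> s) ds\<close> and the law of the process under
  \<open>(s, \<omega>) \<mapsto> X\<^sub>s(\<omega>)\<close>, restricted to the pairs with \<open>s\<close> before the lifetime.
\<close>

lemma resolvent_kernel:
  fixes X :: "('w, 'a::metric_space) process"
  assumes X: "hunt_process X"
  obtains \<kappa> :: "'a \<Rightarrow> 'a measure"
  where "\<And>x. sets (\<kappa> x) = sets borel"
    and "\<And>x h. h \<in> borel_measurable borel \<Longrightarrow> resolvent X \<alpha> h x = (\<integral>\<^sup>+y. h y \<partial>\<kappa> x)"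
proof
  let ?L = "\<lambda>x. law_from X (Some x)"
  let ?Y = "\<lambda>(s, \<omega>). state_at X (ennreal s) \<omega>"
  \<comment> \<open>The last factor is the indicator of being alive; where it vanishes, \<open>the\<close> is irrelevant.\<close>
  let ?w = "\<lambda>p. ennreal (exp (- \<alpha> * fst p)) * indicator {0..} (fst p) * ext0 (\<lambda>_. 1) (?Y p)"
  define \<kappa> where "\<kappa> x = distr (density (lborel \<Otimes>\<^sub>M ?L x) ?w) borel (\<lambda>p. the (?Y p))" for x
  show "sets (\<kappa> x) = sets borel" for x
    by (simp add: \<kappa>_def)
  fix x and h :: "'a \<Rightarrow> ennreal" assume h[measurable]: "h \<in> borel_measurable borel"
  have [measurable]: "?Y \<in> borel \<Otimes>\<^sub>M ?L x \<rightarrow>\<^sub>M cemetery_borel"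
    using hunt_jointly_measurable[OF X]
      measurable_cong_sets[OF sets_pair_measure_cong[OF refl hunt_law_sets[OF X]] refl] by blast
  have [measurable]: "the \<in> (cemetery_borel :: 'a option measure) \<rightarrow>\<^sub>M borel"
  proof (rule measurableI)
    fix B :: "'a set" assume "B \<in> sets borel"
    then have 1: "Some ` B \<in> sets cemetery_borel" by (rule Some_image_in_cemetery_borel)
    note 2 = None_in_cemetery_borel[where 'a='a]
    have 3: "the -` B = Some ` B \<union> (if the None \<in> B then {None} else {})"
    proof (rule set_eqI)
      fix z show "z \<in> the -` B \<longleftrightarrow> z \<in> Some ` B \<union> (if the None \<in> B then {None} else {})"
        by (cases z) auto
    qed
    show "the -` B \<inter> space cemetery_borel \<in> sets cemetery_borel"
      using 1 sets.Un[OF 2 1] by (simp add: 3)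
  qed simp
  interpret L: prob_space "?L x" by (rule hunt_law_prob[OF X])
  interpret pair_sigma_finite lborel "?L x" by unfold_locales
  have "(\<integral>\<^sup>+y. h y \<partial>\<kappa> x) = (\<integral>\<^sup>+p. ?w p * h (the (?Y p)) \<partial>(lborel \<Otimes>\<^sub>M ?L x))"
    unfolding \<kappa>_def by (subst nn_integral_distr) (auto simp: nn_integral_density)
  also have "\<dots> = (\<integral>\<^sup>+\<omega>. \<integral>\<^sup>+s. ?w (s, \<omega>) * h (the (?Y (s, \<omega>))) \<partial>lborel \<partial>?L x)"
    by (rule nn_integral_snd[symmetric]) measurable
  also have "\<dots> = resolvent X \<alpha> h x"
    unfolding resolvent_def
    by (intro nn_integral_cong) (auto simp: ext0_def indicator_def split: option.split)
  finally show "resolvent X \<alpha> h x = (\<integral>\<^sup>+y. h y \<partial>\<kappa> x)" ..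
qed

lemma kernel_mixture:
  fixes \<kappa> :: "'a \<Rightarrow> 'b measure"
  assumes s: "\<And>x. sets (\<kappa> x) = sets N"
    and meas: "\<And>B. B \<in> sets N \<Longrightarrow> (\<lambda>x. emeasure (\<kappa> x) B) \<in> borel_measurable \<nu>"
  obtains \<pi> where "sets \<pi> = sets N"
    and "\<And>h. h \<in> borel_measurable N \<Longrightarrow> (\<integral>\<^sup>+y. h y \<partial>\<pi>) = (\<integral>\<^sup>+x. \<integral>\<^sup>+y. h y \<partial>\<kappa> x \<partial>\<nu>)"
proof
  let ?\<mu> = "\<lambda>B. \<integral>\<^sup>+x. emeasure (\<kappa> x) B \<partial>\<nu>"
  define \<pi> where "\<pi> = measure_of (space N) (sets N) ?\<mu>"
  show sets: "sets \<pi> = sets N"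
    by (simp add: \<pi>_def)
  have em: "emeasure \<pi> B = ?\<mu> B" if B: "B \<in> sets N" for B
    unfolding \<pi>_def
  proof (rule emeasure_measure_of_sigma[OF sets.sigma_algebra_axioms _ _ B])
    show "positive (sets N) ?\<mu>"
      by (simp add: positive_def)
    show "countably_additive (sets N) ?\<mu>"
    proof (rule countably_additiveI)
      fix A :: "nat \<Rightarrow> _" assume A: "range A \<subseteq> sets N" "disjoint_family A"
      have "(\<Sum>i. ?\<mu> (A i)) = (\<integral>\<^sup>+x. (\<Sum>i. emeasure (\<kappa> x) (A i)) \<partial>\<nu>)"
        using A by (intro nn_integral_suminf[symmetric] meas) auto
      also have "\<dots> = ?\<mu> (\<Union>i. A i)"
        using A by (intro nn_integral_cong suminf_emeasure) (auto simp: s)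
      finally show "(\<Sum>i. ?\<mu> (A i)) = ?\<mu> (\<Union>i. A i)" .
    qed
  qed
  note mk = measurable_cong_sets[OF s refl]
  fix h :: "'b \<Rightarrow> ennreal" assume "h \<in> borel_measurable N"
  then have "(\<lambda>x. \<integral>\<^sup>+y. h y \<partial>\<kappa> x) \<in> borel_measurable \<nu> \<and> (\<integral>\<^sup>+y. h y \<partial>\<pi>) = (\<integral>\<^sup>+x. \<integral>\<^sup>+y. h y \<partial>\<kappa> x \<partial>\<nu>)"
  proof (induction rule: borel_measurable_induct)
    case (cong f g)
    then have "(\<integral>\<^sup>+y. f y \<partial>\<kappa> x) = (\<integral>\<^sup>+y. g y \<partial>\<kappa> x)" for x
      by (auto intro!: nn_integral_cong simp: sets_eq_imp_space_eq[OF s])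
    moreover have "(\<integral>\<^sup>+y. f y \<partial>\<pi>) = (\<integral>\<^sup>+y. g y \<partial>\<pi>)"
      by (rule nn_integral_cong) (simp add: cong(3) sets_eq_imp_space_eq[OF sets])
    ultimately show ?case using cong by simp
  next
    case (set A)
    then show ?case using meas[OF set] by (simp add: s sets em)
  next
    case (mult u c)
    then have [measurable]: "(\<lambda>x. \<integral>\<^sup>+y. u y \<partial>\<kappa> x) \<in> borel_measurable \<nu>" by blast
    from mult show ?case
      by (simp add: nn_integral_cmult mk measurable_cong_sets[OF sets refl])
  next
    case (add u v)
    then have [measurable]: "(\<lambda>x. \<integral>\<^sup>+y. u y \<partial>\<kappa> x) \<in> borel_measurable \<nu>"
      "(\<lambda>x. \<integral>\<^sup>+y. v y \<partial>\<kappa> x) \<in> borel_measurable \<nu>" by blast+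
    from add show ?case
      by (simp add: nn_integral_add mk measurable_cong_sets[OF sets refl])
  next
    case (seq U)
    then have [measurable]: "(\<lambda>x. \<integral>\<^sup>+y. U i y \<partial>\<kappa> x) \<in> borel_measurable \<nu>" for i by blast
    have 1: "(\<integral>\<^sup>+y. (SUP i. U i) y \<partial>\<kappa> x) = (SUP i. \<integral>\<^sup>+y. U i y \<partial>\<kappa> x)" for x
      unfolding SUP_apply using seq
      by (intro nn_integral_monotone_convergence_SUP) (auto simp: mk)
    have "(\<integral>\<^sup>+y. (SUP i. U i) y \<partial>\<pi>) = (SUP i. \<integral>\<^sup>+y. U i y \<partial>\<pi>)"
      unfolding SUP_apply using seq
      by (intro nn_integral_monotone_convergence_SUP) (auto simp: measurable_cong_sets[OF sets refl])
    also have "\<dots> = (SUP i. \<integral>\<^sup>+x. \<integral>\<^sup>+y. U i y \<partial>\<kappa> x \<partial>\<nu>)"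
      using seq by simp
    also have "\<dots> = (\<integral>\<^sup>+x. (SUP i. \<integral>\<^sup>+y. U i y \<partial>\<kappa> x) \<partial>\<nu>)"
      using seq
      by (intro nn_integral_monotone_convergence_SUP[symmetric])
        (auto simp: incseq_def le_fun_def intro!: nn_integral_mono)
    finally have 2: "(\<integral>\<^sup>+y. (SUP i. U i) y \<partial>\<pi>) = (\<integral>\<^sup>+x. (SUP i. \<integral>\<^sup>+y. U i y \<partial>\<kappa> x) \<partial>\<nu>)" .
    have 3: "(\<lambda>x. SUP i. \<integral>\<^sup>+y. U i y \<partial>\<kappa> x) \<in> borel_measurable \<nu>"
      by measurable
    show ?case unfolding 1 using 2 3 by (rule conjI[rotated])
  qed
  then show "(\<integral>\<^sup>+y. h y \<partial>\<pi>) = (\<integral>\<^sup>+x. \<integral>\<^sup>+y. h y \<partial>\<kappa> x \<partial>\<nu>)" ..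
qed

text \<open>
  On a set \<open>S\<close> of finite measure where \<open>V > C\<close>, the hypothesis forces the integral of \<open>V - C\<close>
  over \<open>S\<close> to vanish; \<open>\<sigma>\<close>-finiteness provides enough such sets.
\<close>

lemma (in sigma_finite_measure) AE_le_const_if_density_le:
  assumes [measurable]: "V \<in> borel_measurable M"
    and le: "\<And>A. A \<in> sets M \<Longrightarrow> (\<integral>\<^sup>+x\<in>A. V x \<partial>M) \<le> ennreal C * emeasure M A"
  shows "AE x in M. V x \<le> ennreal C"
proof -
  obtain A :: "nat \<Rightarrow> 'a set" where A: "range A \<subseteq> sets M" "(\<Union>i. A i) = space M" "\<And>i. emeasure M (A i) \<noteq> \<infinity>"
    using sigma_finite by metis
  have "AE x in M. x \<in> A i \<longrightarrow> V x \<le> ennreal C" for i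
  proof -
    define S where "S = {x \<in> space M. ennreal C < V x} \<inter> A i"
    have [measurable]: "A i \<in> sets M" using A by auto
    have S[measurable]: "S \<in> sets M" unfolding S_def by measurable
    have "emeasure M S \<le> emeasure M (A i)"
      by (rule emeasure_mono) (auto simp: S_def)
    then have fin: "ennreal C * emeasure M S < top"
      using A(3)[of i] by (auto simp: ennreal_mult_eq_top_iff less_top[symmetric] top_unique)
    have "ennreal C * emeasure M S + (\<integral>\<^sup>+x. (V x - ennreal C) * indicator S x \<partial>M)
        = (\<integral>\<^sup>+x. ennreal C * indicator S x + (V x - ennreal C) * indicator S x \<partial>M)"
      by (subst nn_integral_add) (auto simp: nn_integral_cmult_indicator)
    also have "\<dots> = (\<integral>\<^sup>+x\<in>S. V x \<partial>M)"
      by (intro nn_integral_cong) (auto simp: S_def indicator_def less_imp_le)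
    also have "\<dots> \<le> ennreal C * emeasure M S + 0"
      using le[OF S] by simp
    finally have "(\<integral>\<^sup>+x. (V x - ennreal C) * indicator S x \<partial>M) = 0"
      using fin by (subst (asm) ennreal_add_left_cancel_le) auto
    then have "AE x in M. (V x - ennreal C) * indicator S x = 0"
      by (subst (asm) nn_integral_0_iff_AE) auto
    then show ?thesis
      using AE_space
    proof eventually_elim
      case (elim x)
      then show ?case
        by (auto simp: S_def indicator_def diff_eq_0_iff_ennreal split: if_splits)
    qed
  qed
  then have "AE x in M. \<forall>i. x \<in> A i \<longrightarrow> V x \<le> ennreal C"
    unfolding AE_all_countable by blast
  then show ?thesis
    using AE_space by eventually_elim (use A(2) in blast)
qed

text \<open>
  The measure \<open>\<nu> R\<^sub>\<alpha>\<close> is dominated by \<open>C m\<close>, so it has a density \<open>V \<le> C\<close> by the Radon-Nikodym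
  theorem.  This \<open>V\<close> is a version of the \<open>\<alpha>\<close>-potential of \<open>\<nu>\<close>; obtaining it as a density makes it a
  bounded Borel function.
\<close>

lemma bounded_potential_density:
  fixes X :: "('w, 'a::metric_space) process"
  assumes X: "hunt_process X" and \<nu>: "sets \<nu> = sets borel"
    and m: "sigma_finite_measure m" "sets m = sets borel" and C: "0 \<le> C"
    and le: "\<And>h. h \<in> borel_measurable borel \<Longrightarrow> (\<integral>\<^sup>+x. resolvent X \<alpha> h x \<partial>\<nu>) \<le> ennreal C * (\<integral>\<^sup>+x. h x \<partial>m)"
  obtains V :: "'a \<Rightarrow> real" where "V \<in> borel_measurable borel" "\<And>x. 0 \<le> V x" "\<And>x. V x \<le> C"
    "\<And>h. h \<in> borel_measurable borel \<Longrightarrow> (\<integral>\<^sup>+x. resolvent X \<alpha> h x \<partial>\<nu>) = (\<integral>\<^sup>+x. h x * ennreal (V x) \<partial>m)"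
proof -
  interpret m: sigma_finite_measure m by (rule m)
  obtain \<kappa> :: "'a \<Rightarrow> 'a measure" where \<kappa>: "\<And>x. sets (\<kappa> x) = sets borel"
    "\<And>x h. h \<in> borel_measurable borel \<Longrightarrow> resolvent X \<alpha> h x = (\<integral>\<^sup>+y. h y \<partial>\<kappa> x)"
    using resolvent_kernel[OF X, of \<alpha>] by metis
  have "(\<lambda>x. emeasure (\<kappa> x) B) \<in> borel_measurable \<nu>" if B: "B \<in> sets borel" for B
  proof -
    have ind: "(indicator B :: 'a \<Rightarrow> ennreal) \<in> borel_measurable borel" using B by simp
    have "emeasure (\<kappa> x) B = resolvent X \<alpha> (indicator B) x" for x
      using B \<kappa>(2)[OF ind, of x] by (simp add: \<kappa>(1))
    then show ?thesis
      using resolvent_measurable[OF X ind, of \<alpha>] by (simp add: measurable_cong_sets[OF \<nu> refl])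
  qed
  from kernel_mixture[of \<kappa> borel \<nu>, OF \<kappa>(1) this] obtain \<pi> where
    \<pi>: "sets \<pi> = sets borel" "\<And>h. h \<in> borel_measurable borel \<Longrightarrow> (\<integral>\<^sup>+y. h y \<partial>\<pi>) = (\<integral>\<^sup>+x. resolvent X \<alpha> h x \<partial>\<nu>)"
    by (metis (no_types, lifting) \<kappa>(2) nn_integral_cong)
  have le\<pi>: "emeasure \<pi> B \<le> ennreal C * emeasure m B" if B: "B \<in> sets m" for B
    using \<pi>(2)[of "indicator B"] le[of "indicator B"] B by (simp add: \<pi>(1) m(2))
  have "absolutely_continuous m \<pi>"
    unfolding absolutely_continuous_def
  proof
    fix B assume "B \<in> null_sets m"
    then show "B \<in> null_sets \<pi>"
      using le\<pi>[of B] by (auto simp: null_sets_def \<pi>(1) m(2))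
  qed
  from m.Radon_Nikodym[OF this] obtain W where W: "W \<in> borel_measurable m" "density m W = \<pi>"
    by (auto simp: \<pi>(1) m(2))
  have "AE x in m. W x \<le> ennreal C"
  proof (rule m.AE_le_const_if_density_le[OF W(1)])
    fix A assume A: "A \<in> sets m"
    then have "(\<integral>\<^sup>+x\<in>A. W x \<partial>m) = emeasure \<pi> A"
      unfolding W(2)[symmetric] by (simp add: emeasure_density[OF W(1)])
    with le\<pi>[OF A] show "(\<integral>\<^sup>+x\<in>A. W x \<partial>m) \<le> ennreal C * emeasure m A" by simp
  qed
  then have WV: "AE x in m. W x = ennreal (enn2real (min (W x) (ennreal C)))"
  proof eventually_elim
    case (elim x)
    then have "W x < top" by (rule le_less_trans) simp
    with elim show ?case by (simp add: min_absorb1)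
  qed
  have Wb[measurable]: "W \<in> borel_measurable borel"
    using W(1) by (simp add: measurable_cong_sets[OF m(2) refl])
  show thesis
  proof (rule that[of "\<lambda>x. enn2real (min (W x) (ennreal C))"])
    show "(\<lambda>x. enn2real (min (W x) (ennreal C))) \<in> borel_measurable borel"
      by measurable
    show "enn2real (min (W x) (ennreal C)) \<le> C" for x
      using enn2real_mono[of "min (W x) (ennreal C)" "ennreal C"] C by simp
    fix h :: "'a \<Rightarrow> ennreal" assume h: "h \<in> borel_measurable borel"
    then have hm: "h \<in> borel_measurable m" by (simp add: measurable_cong_sets[OF m(2) refl])
    have "(\<integral>\<^sup>+x. resolvent X \<alpha> h x \<partial>\<nu>) = (\<integral>\<^sup>+x. W x * h x \<partial>m)"
      unfolding \<pi>(2)[OF h, symmetric] W(2)[symmetric] by (rule nn_integral_density[OF W(1) hm])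
    also have "\<dots> = (\<integral>\<^sup>+x. h x * ennreal (enn2real (min (W x) (ennreal C))) \<partial>m)"
      using WV by (intro nn_integral_cong_AE) (auto simp: mult.commute)
    finally show "(\<integral>\<^sup>+x. resolvent X \<alpha> h x \<partial>\<nu>) = (\<integral>\<^sup>+x. h x * ennreal (enn2real (min (W x) (ennreal C))) \<partial>m)" .
  qed simp
qed

section \<open>The energy inequality for bounded potentials\<close>

text \<open>
  In operator notation, \<open>\<langle>h, V - exp (- \<alpha> t) P\<^sub>t V\<rangle> = \<integral>\<^sub>0\<^sup>t exp (- \<alpha> s) \<nu>(P\<^sub>s h) ds\<close>.  Divided by \<open>t\<close>, it
  is an approximate form of \<open>\<E>\<^sub>\<alpha>(h, V) = \<nu>(h)\<close> that makes sense whether or not \<open>V\<close> lies in the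
  domain of the form, and that does not involve quasi-continuous versions.
\<close>

lemma potential_density_split:
  fixes X :: "('w, 'a::metric_space) process"
  assumes X: "hunt_process X" and \<nu>: "finite_measure \<nu>" "sets \<nu> = sets borel"
    and V: "\<And>h. h \<in> borel_measurable borel \<Longrightarrow> (\<integral>\<^sup>+x. resolvent X \<alpha> h x \<partial>\<nu>) = (\<integral>\<^sup>+x. h x * ennreal (V x) \<partial>m)"
    and h[measurable]: "h \<in> borel_measurable borel" and t: "0 \<le> t"
  shows "(\<integral>\<^sup>+x. h x * ennreal (V x) \<partial>m) =
    (\<integral>\<^sup>+s\<in>{0..<t}. ennreal (exp (- \<alpha> * s)) * (\<integral>\<^sup>+x. nn_transition X s h x \<partial>\<nu>) \<partial>lborel) +
    ennreal (exp (- \<alpha> * t)) * (\<integral>\<^sup>+x. nn_transition X t h x * ennreal (V x) \<partial>m)"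
proof -
  interpret finite_measure \<nu> by fact
  interpret pair_sigma_finite lborel \<nu> by unfold_locales
  let ?P = "\<lambda>(s, x). nn_transition X s h x"
  have [measurable]: "?P \<in> borel_measurable (borel \<Otimes>\<^sub>M \<nu>)"
    using nn_transition_jointly_measurable[OF X h]
      measurable_cong_sets[OF sets_pair_measure_cong[OF refl \<nu>(2)] refl] by blast
  have [measurable]: "resolvent X \<alpha> (nn_transition X t h) \<in> borel_measurable \<nu>"
    using resolvent_measurable[OF X nn_transition_measurable[OF X h]] by (simp add: measurable_cong_sets[OF \<nu>(2) refl])
  let ?g = "\<lambda>s x. ennreal (exp (- \<alpha> * s)) * ?P (s, x) * indicator {0..<t} s"
  have g: "(\<lambda>(s, x). ?g s x) \<in> borel_measurable (lborel \<Otimes>\<^sub>M \<nu>)"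
    by measurable
  have [measurable]: "(\<lambda>x. \<integral>\<^sup>+s. ?g s x \<partial>lborel) \<in> borel_measurable \<nu>"
    by measurable
  have "(\<integral>\<^sup>+x. h x * ennreal (V x) \<partial>m) = (\<integral>\<^sup>+x. resolvent X \<alpha> h x \<partial>\<nu>)"
    by (rule V[OF h, symmetric])
  also have "\<dots> = (\<integral>\<^sup>+x. (\<integral>\<^sup>+s. ?g s x \<partial>lborel) + ennreal (exp (- \<alpha> * t)) * resolvent X \<alpha> (nn_transition X t h) x \<partial>\<nu>)"
    by (simp add: resolvent_split[OF X h t])
  also have "\<dots> = (\<integral>\<^sup>+x. \<integral>\<^sup>+s. ?g s x \<partial>lborel \<partial>\<nu>)
      + ennreal (exp (- \<alpha> * t)) * (\<integral>\<^sup>+x. resolvent X \<alpha> (nn_transition X t h) x \<partial>\<nu>)"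
    by (subst nn_integral_add) (auto simp: nn_integral_cmult)
  also have "(\<integral>\<^sup>+x. \<integral>\<^sup>+s. ?g s x \<partial>lborel \<partial>\<nu>) = (\<integral>\<^sup>+s. \<integral>\<^sup>+x. ?g s x \<partial>\<nu> \<partial>lborel)"
    by (rule Fubini'[OF g])
  also have "\<dots> = (\<integral>\<^sup>+s\<in>{0..<t}. ennreal (exp (- \<alpha> * s)) * (\<integral>\<^sup>+x. nn_transition X s h x \<partial>\<nu>) \<partial>lborel)"
  proof (intro nn_integral_cong)
    fix s :: real
    have "nn_transition X s h \<in> borel_measurable \<nu>"
      using nn_transition_measurable[OF X h] by (simp add: measurable_cong_sets[OF \<nu>(2) refl])
    then show "(\<integral>\<^sup>+x. ?g s x \<partial>\<nu>) = ennreal (exp (- \<alpha> * s)) * (\<integral>\<^sup>+x. nn_transition X s h x \<partial>\<nu>) * indicator {0..<t} s"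
      by (simp add: nn_integral_cmult nn_integral_multc)
  qed
  also have "(\<integral>\<^sup>+x. resolvent X \<alpha> (nn_transition X t h) x \<partial>\<nu>) = (\<integral>\<^sup>+x. nn_transition X t h x * ennreal (V x) \<partial>m)"
    by (rule V[OF nn_transition_measurable[OF X h]])
  finally show ?thesis .
qed

lemma nn_integral_Ico_const: "0 \<le> t \<Longrightarrow> (\<integral>\<^sup>+s\<in>{0..<t}. c \<partial>lborel) = c * ennreal (t::real)"
  by (subst nn_integral_cmult_indicator) auto

text \<open>
  The integral of \<open>V\<close> is at most \<open>\<nu>(R\<^sub>1 1) \<le> \<nu>(1)\<close>, and \<open>V\<^sup>2 \<le> C V\<close>.
\<close>

lemma potential_density_square_integrable:
  fixes X :: "('w, 'a::metric_space) process"
  assumes X: "hunt_process X" and \<nu>: "finite_measure \<nu>" "sets \<nu> = sets borel"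
    and m: "sets m = sets borel"
    and V: "\<And>h. h \<in> borel_measurable borel \<Longrightarrow> (\<integral>\<^sup>+x. resolvent X 1 h x \<partial>\<nu>) = (\<integral>\<^sup>+x. h x * ennreal (V x) \<partial>m)"
    and Vm: "V \<in> borel_measurable borel" and V0: "\<And>x. 0 \<le> V x" and VC: "\<And>x. V x \<le> C"
  shows "integrable m (\<lambda>x. (V x)\<^sup>2)"
proof (rule integrableI_nonneg)
  interpret finite_measure \<nu> by fact
  have C: "0 \<le> C" using order_trans[OF V0 VC] .
  show "(\<lambda>x. (V x)\<^sup>2) \<in> borel_measurable m"
    using Vm by (simp add: measurable_cong_sets[OF m refl])
  have "(\<integral>\<^sup>+x. ennreal ((V x)\<^sup>2) \<partial>m) \<le> (\<integral>\<^sup>+x. ennreal C * (1 * ennreal (V x)) \<partial>m)"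
    by (intro nn_integral_mono)
      (simp add: ennreal_mult[symmetric] V0 C power2_eq_square mult_right_mono VC)
  also have "\<dots> = ennreal C * (\<integral>\<^sup>+x. 1 * ennreal (V x) \<partial>m)"
    using Vm by (intro nn_integral_cmult) (simp add: measurable_cong_sets[OF m refl])
  also have "(\<integral>\<^sup>+x. 1 * ennreal (V x) \<partial>m) = (\<integral>\<^sup>+x. resolvent X 1 (\<lambda>_. 1) x \<partial>\<nu>)"
    by (rule V[symmetric]) simp
  also have "\<dots> \<le> (\<integral>\<^sup>+x. 1 \<partial>\<nu>)"
    by (intro nn_integral_mono resolvent_1_le[OF X])
  also have "\<dots> = emeasure \<nu> (space \<nu>)" by simp
  also have "ennreal C * emeasure \<nu> (space \<nu>) < \<infinity>"
    by (simp add: ennreal_mult_eq_top_iff less_top[symmetric])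
  finally show "(\<integral>\<^sup>+x. ennreal ((V x)\<^sup>2) \<partial>m) < \<infinity>"
    by (auto simp: mult_left_mono)
qed simp

lemma potential_density_pairing:
  fixes X :: "('w, 'a::metric_space) process"
  assumes X: "hunt_process X" and sym: "symmetric_process m X"
    and \<nu>: "finite_measure \<nu>" "sets \<nu> = sets borel"
    and m: "sets m = sets borel"
    and V: "\<And>h. h \<in> borel_measurable borel \<Longrightarrow> (\<integral>\<^sup>+x. resolvent X 1 h x \<partial>\<nu>) = (\<integral>\<^sup>+x. h x * ennreal (V x) \<partial>m)"
    and Vm: "V \<in> borel_measurable borel" and V0: "\<And>x. 0 \<le> V x" and VC: "\<And>x. V x \<le> C"
    and g: "g \<in> borel_measurable borel" "\<And>x. 0 \<le> g x" "\<And>x. g x \<le> d" "integrable m (\<lambda>x. (g x)\<^sup>2)"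
    and t: "0 \<le> t"
  shows "ennreal ((LINT x|m. g x * V x) - exp (- t) * (LINT x|m. V x * transition X t g x)) =
    (\<integral>\<^sup>+s\<in>{0..<t}. ennreal (exp (- s)) * (\<integral>\<^sup>+x. nn_transition X s (\<lambda>y. ennreal (g y)) x \<partial>\<nu>) \<partial>lborel)"
    (is "ennreal (?A - exp (- t) * ?B) = ?I")
    and "exp (- t) * (LINT x|m. V x * transition X t g x) \<le> (LINT x|m. g x * V x)"
proof -
  note V2 = potential_density_square_integrable[OF X \<nu> m V Vm V0 VC]
  have gb: "\<bar>g x\<bar> \<le> d" for x using g by (simp add: abs_of_nonneg)
  have gm: "g \<in> borel_measurable m" "V \<in> borel_measurable m"
    using g Vm by (simp_all add: measurable_cong_sets[OF m refl])
  have iA: "integrable m (\<lambda>x. g x * V x)"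
    by (rule integrable_mult_square_integrable[OF gm g(4) V2])
  have iB: "integrable m (\<lambda>x. V x * transition X t g x)"
    by (rule transition_integrable_mult[OF X sym m t g(1) gb g(4) Vm V2])
  have "ennreal ?A = (\<integral>\<^sup>+x. ennreal (g x * V x) \<partial>m)"
    by (rule nn_integral_eq_integral[OF iA, symmetric]) (simp add: g V0)
  also have "\<dots> = (\<integral>\<^sup>+x. ennreal (g x) * ennreal (V x) \<partial>m)"
    by (simp add: ennreal_mult g V0)
  also have "\<dots> = ?I + ennreal (exp (- t)) * (\<integral>\<^sup>+x. nn_transition X t (\<lambda>y. ennreal (g y)) x * ennreal (V x) \<partial>m)"
    using potential_density_split[OF X \<nu> V, of "\<lambda>y. ennreal (g y)" t] g(1) t by simp
  also have "(\<integral>\<^sup>+x. nn_transition X t (\<lambda>y. ennreal (g y)) x * ennreal (V x) \<partial>m)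
      = (\<integral>\<^sup>+x. ennreal (V x * transition X t g x) \<partial>m)"
    by (intro nn_integral_cong)
      (simp add: ennreal_mult V0 transition_nonneg[OF g(2)] ennreal_transition[OF X g(1,3,2)] mult.commute)
  also have "\<dots> = ennreal ?B"
    by (rule nn_integral_eq_integral[OF iB]) (simp add: V0 transition_nonneg[OF g(2)])
  finally have eq: "ennreal ?A = ?I + ennreal (exp (- t) * ?B)"
    by (simp add: ennreal_mult')
  have A0: "0 \<le> ?A" and B0: "0 \<le> ?B"
    by (auto intro!: integral_nonneg_AE simp: g V0 transition_nonneg[OF g(2)])
  have "ennreal (exp (- t) * ?B) \<le> ennreal ?A"
    unfolding eq by simp
  then show le: "exp (- t) * ?B \<le> ?A"
    using A0 by (simp add: ennreal_le_iff)
  show "ennreal (?A - exp (- t) * ?B) = ?I"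
    using B0 by (simp add: ennreal_minus[symmetric] eq)
qed

text \<open>
  The approximate form of \<open>\<E>\<^sub>1(V, V) = \<nu>(V) \<le> C \<nu>(1)\<close>.  It holds at every \<open>t\<close> because the Borel
  version of \<open>V\<close> is bounded by \<open>C\<close> at every point, hence so is every \<open>P\<^sub>s V\<close>.
\<close>

lemma potential_energy_bound:
  fixes X :: "('w, 'a::metric_space) process"
  assumes X: "hunt_process X" and sym: "symmetric_process m X"
    and \<nu>: "finite_measure \<nu>" "sets \<nu> = sets borel"
    and m: "sets m = sets borel"
    and V: "\<And>h. h \<in> borel_measurable borel \<Longrightarrow> (\<integral>\<^sup>+x. resolvent X 1 h x \<partial>\<nu>) = (\<integral>\<^sup>+x. h x * ennreal (V x) \<partial>m)"
    and Vm: "V \<in> borel_measurable borel" and V0: "\<And>x. 0 \<le> V x" and VC: "\<And>x. V x \<le> C"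
    and t: "0 \<le> t"
  shows "(LINT x|m. (V x)\<^sup>2) - exp (- t) * (LINT x|m. V x * transition X t V x) \<le> t * (C * measure \<nu> UNIV)"
proof -
  interpret finite_measure \<nu> by fact
  have sp: "space \<nu> = UNIV" using sets_eq_imp_space_eq[OF \<nu>(2)] by simp
  have C: "0 \<le> C" using order_trans[OF V0 VC] .
  have "ennreal ((LINT x|m. V x * V x) - exp (- t) * (LINT x|m. V x * transition X t V x)) =
      (\<integral>\<^sup>+s\<in>{0..<t}. ennreal (exp (- s)) * (\<integral>\<^sup>+x. nn_transition X s (\<lambda>y. ennreal (V y)) x \<partial>\<nu>) \<partial>lborel)"
    by (rule potential_density_pairing(1)[OF X sym \<nu> m V Vm V0 VC Vm V0 VC
        potential_density_square_integrable[OF X \<nu> m V Vm V0 VC] t])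
  also have "\<dots> \<le> (\<integral>\<^sup>+s\<in>{0..<t}. 1 * (\<integral>\<^sup>+x. ennreal C \<partial>\<nu>) \<partial>lborel)"
  proof (rule nn_integral_mono)
    fix s :: real
    show "ennreal (exp (- s)) * (\<integral>\<^sup>+x. nn_transition X s (\<lambda>y. ennreal (V y)) x \<partial>\<nu>) * indicator {0..<t} s
        \<le> 1 * (\<integral>\<^sup>+x. ennreal C \<partial>\<nu>) * indicator {0..<t} s"
    proof (cases "s \<in> {0..<t}")
      case True
      then show ?thesis
        by (intro mult_mono nn_integral_mono nn_transition_le_const[OF X] ennreal_leI VC)
          (auto simp: ennreal_le_1)
    qed simp
  qed
  also have "\<dots> = ennreal (t * (C * measure \<nu> UNIV))"
    unfolding nn_integral_Ico_const[OF t]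
    using t C by (simp add: sp emeasure_eq_measure ennreal_mult[symmetric] ac_simps)
  finally show ?thesis
    using t C by (simp add: ennreal_le_iff power2_eq_square)
qed

text \<open>
  The lower half of \<open>\<E>\<^sub>1(V, g) = \<nu>(g)\<close> in approximate form: \<open>exp (- s) \<ge> exp (- t)\<close> before time \<open>t\<close>,
  and \<open>a\<close> stands for a number slightly below \<open>\<nu>(g)\<close>.
\<close>

lemma potential_pairing_lower_bound:
  fixes X :: "('w, 'a::metric_space) process"
  assumes X: "hunt_process X" and sym: "symmetric_process m X"
    and \<nu>: "finite_measure \<nu>" "sets \<nu> = sets borel"
    and m: "sets m = sets borel"
    and V: "\<And>h. h \<in> borel_measurable borel \<Longrightarrow> (\<integral>\<^sup>+x. resolvent X 1 h x \<partial>\<nu>) = (\<integral>\<^sup>+x. h x * ennreal (V x) \<partial>m)"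
    and Vm: "V \<in> borel_measurable borel" and V0: "\<And>x. 0 \<le> V x" and VC: "\<And>x. V x \<le> C"
    and g: "g \<in> borel_measurable borel" "\<And>x. 0 \<le> g x" "\<And>x. g x \<le> d" "integrable m (\<lambda>x. (g x)\<^sup>2)"
    and t: "0 \<le> t"
    and a: "\<And>s. 0 < s \<Longrightarrow> s < t \<Longrightarrow> a \<le> (LINT x|\<nu>. transition X s g x)"
  shows "t * (exp (- t) * a) \<le> (LINT x|m. g x * V x) - exp (- t) * (LINT x|m. V x * transition X t g x)"
proof (cases "a \<le> 0")
  case True
  then have "t * (exp (- t) * a) \<le> 0"
    using t by (simp add: mult_nonneg_nonpos)
  with potential_density_pairing(2)[OF X sym \<nu> m V Vm V0 VC g t] show ?thesis by simp
next
  case False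
  interpret finite_measure \<nu> by fact
  have a0: "0 \<le> a" using False by simp
  have "ennreal (t * (exp (- t) * a)) = (\<integral>\<^sup>+s\<in>{0..<t}. ennreal (exp (- t) * a) \<partial>lborel)"
    unfolding nn_integral_Ico_const[OF t]
    using t a0 by (simp add: ennreal_mult[symmetric] ac_simps)
  also have "\<dots> \<le> (\<integral>\<^sup>+s\<in>{0..<t}. ennreal (exp (- s)) * (\<integral>\<^sup>+x. nn_transition X s (\<lambda>y. ennreal (g y)) x \<partial>\<nu>) \<partial>lborel)"
  proof (rule nn_integral_mono_AE)
    have "AE s in lborel. s \<noteq> (0::real)" by (rule AE_lborel_singleton)
    then show "AE s in lborel. ennreal (exp (- t) * a) * indicator {0..<t} s
        \<le> ennreal (exp (- s)) * (\<integral>\<^sup>+x. nn_transition X s (\<lambda>y. ennreal (g y)) x \<partial>\<nu>) * indicator {0..<t} s"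
    proof eventually_elim
      case (elim s)
      show ?case
      proof (cases "s \<in> {0..<t}")
        case True
        with elim have s: "0 < s" "s < t" by auto
        have gm: "transition X s g \<in> borel_measurable \<nu>"
          using transition_measurable[OF X g(1)] by (simp add: measurable_cong_sets[OF \<nu>(2) refl])
        have "ennreal a \<le> ennreal (LINT x|\<nu>. transition X s g x)"
          by (rule ennreal_leI[OF a[OF s]])
        also have "\<dots> = (\<integral>\<^sup>+x. ennreal (transition X s g x) \<partial>\<nu>)"
        proof (rule nn_integral_eq_integral[symmetric])
          show "AE x in \<nu>. 0 \<le> transition X s g x"
            by (simp add: transition_nonneg[OF g(2)])
          show "integrable \<nu> (transition X s g)"
          proof (rule integrableI_nonneg[OF gm])
            have "(\<integral>\<^sup>+x. ennreal (transition X s g x) \<partial>\<nu>) \<le> (\<integral>\<^sup>+x. ennreal d \<partial>\<nu>)"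
              unfolding ennreal_transition[OF X g(1,3,2)]
              by (intro nn_integral_mono nn_transition_le_const[OF X] ennreal_leI g)
            also have "\<dots> < \<infinity>"
              by (simp add: ennreal_mult_eq_top_iff less_top[symmetric])
            finally show "(\<integral>\<^sup>+x. ennreal (transition X s g x) \<partial>\<nu>) < \<infinity>" .
          qed (simp add: transition_nonneg[OF g(2)])
        qed
        also have "\<dots> = (\<integral>\<^sup>+x. nn_transition X s (\<lambda>y. ennreal (g y)) x \<partial>\<nu>)"
          by (simp add: ennreal_transition[OF X g(1,3,2)])
        finally have "ennreal (exp (- t)) * ennreal a \<le>
            ennreal (exp (- s)) * (\<integral>\<^sup>+x. nn_transition X s (\<lambda>y. ennreal (g y)) x \<partial>\<nu>)"
          using s by (intro mult_mono) (auto intro: ennreal_leI)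
        with True show ?thesis using a0 by (simp add: ennreal_mult)
      qed simp
    qed
  qed
  also have "\<dots> = ennreal ((LINT x|m. g x * V x) - exp (- t) * (LINT x|m. V x * transition X t g x))"
    by (rule potential_density_pairing(1)[OF X sym \<nu> m V Vm V0 VC g t, symmetric])
  finally show ?thesis
    using potential_density_pairing(2)[OF X sym \<nu> m V Vm V0 VC g t] by (simp add: ennreal_le_iff)
qed

text \<open>
  Expanding \<open>0 \<le> \<E>\<^sub>1(V - C f, V - C f)\<close> with \<open>\<E>\<^sub>1(V, V) \<le> C \<nu>(1)\<close> and \<open>\<E>\<^sub>1(V, f) = \<nu>(f)\<close> gives
  \<open>2 C \<nu>(f) \<le> C \<nu>(1) + C\<^sup>2 \<E>\<^sub>1(f, f)\<close>.  If \<open>f = 1\<close> holds \<open>\<nu>\<close>-almost everywhere, the two masses can be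
  subtracted, and the mass of \<open>\<nu>\<close> is bounded by a constant that depends only on \<open>f\<close> and \<open>C\<close>.
\<close>

lemma bounded_potential_energy_inequality:
  fixes X :: "('w, 'a::metric_space) process"
  assumes X: "hunt_process X" and sym: "symmetric_process m X"
    and \<nu>: "finite_measure \<nu>" "sets \<nu> = sets borel"
    and m: "sigma_finite_measure m" "sets m = sets borel" and C: "0 < C"
    and le: "\<And>h. h \<in> borel_measurable borel \<Longrightarrow> (\<integral>\<^sup>+x. resolvent X 1 h x \<partial>\<nu>) \<le> ennreal C * (\<integral>\<^sup>+x. h x \<partial>m)"
    and f: "continuous_on UNIV f" "\<And>x. 0 \<le> f x" "\<And>x. f x \<le> 1" "integrable m (\<lambda>x. (f x)\<^sup>2)"
    and E: "((\<lambda>t. approx_form m X t f f) \<longlongrightarrow> E) (at_right 0)"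
  shows "2 * (LINT x|\<nu>. f x) \<le> measure \<nu> UNIV + C * (E + (LINT x|m. (f x)\<^sup>2))"
proof -
  have fm: "f \<in> borel_measurable borel" using f(1) by (rule borel_measurable_continuous_onI)
  have fb: "\<bar>f x\<bar> \<le> 1" for x using f by (simp add: abs_of_nonneg)
  obtain V where Vm: "V \<in> borel_measurable borel" and V0: "\<And>x. 0 \<le> V x" and VC: "\<And>x. V x \<le> C"
    and V: "\<And>h. h \<in> borel_measurable borel \<Longrightarrow> (\<integral>\<^sup>+x. resolvent X 1 h x \<partial>\<nu>) = (\<integral>\<^sup>+x. h x * ennreal (V x) \<partial>m)"
    using bounded_potential_density[OF X \<nu>(2) m less_imp_le[OF C] le] by metis
  note V2 = potential_density_square_integrable[OF X \<nu> m(2) V Vm V0 VC]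
  let ?F = "LINT x|m. (f x)\<^sup>2" and ?M = "LINT x|\<nu>. f x" and ?N = "measure \<nu> UNIV"
  have main: "2 * C * (exp (- t) * a) \<le> C * ?N + C\<^sup>2 * (approx_form m X t f f + ?F)"
    if t: "0 < t" and a: "\<And>s. 0 < s \<Longrightarrow> s < t \<Longrightarrow> a \<le> (LINT x|\<nu>. transition X s f x)" for t a
  proof -
    have t0: "0 \<le> t" using t by simp
    let ?D = "LINT x|m. f x * transition X t f x"
    have iD: "integrable m (\<lambda>x. f x * transition X t f x)"
      by (rule transition_integrable_mult[OF X sym m(2) t0 fm fb f(4) fm f(4)])
    have "t * approx_form m X t f f = (LINT x|m. (f x)\<^sup>2 - f x * transition X t f x)"
      using t by (simp add: approx_form_def power2_eq_square algebra_simps)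
    also have "\<dots> = ?F - ?D"
      using iD f(4) by simp
    finally have app: "t * approx_form m X t f f = ?F - ?D" .
    have D0: "0 \<le> ?D"
      by (auto intro!: integral_nonneg_AE simp: f transition_nonneg[OF f(2)])
    have DF: "?D \<le> ?F" by (rule transition_form_le[OF X sym m(2) t0 fm fb f(4)])
    \<comment> \<open>Discounting costs at most \<open>t\<close> times the squared norm, which turns \<open>\<E>\<close> into \<open>\<E>\<^sub>1\<close>.\<close>
    have "(1 - exp (- t)) * ?D \<le> t * ?F"
      using D0 DF t exp_ge_add_one_self[of "- t"] by (intro mult_mono) auto
    then have ff: "?F - exp (- t) * ?D \<le> t * (approx_form m X t f f + ?F)"
      using app by (simp add: algebra_simps)
    have "2 * C * (t * (exp (- t) * a)) \<le>
        2 * C * ((LINT x|m. f x * V x) - exp (- t) * (LINT x|m. V x * transition X t f x))"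
      using potential_pairing_lower_bound[OF X sym \<nu> m(2) V Vm V0 VC fm f(2,3,4) t0 a] C
      by (intro mult_left_mono) auto
    also have "\<dots> \<le> ((LINT x|m. (V x)\<^sup>2) - exp (- t) * (LINT x|m. V x * transition X t V x))
        + C\<^sup>2 * (?F - exp (- t) * ?D)"
      by (rule discounted_form_nonneg_on_difference[OF X sym m(2) t0 Vm V0 VC V2 fm f(2,3,4)])
    also have "\<dots> \<le> t * (C * ?N) + C\<^sup>2 * (t * (approx_form m X t f f + ?F))"
      by (intro add_mono mult_left_mono ff potential_energy_bound[OF X sym \<nu> m(2) V Vm V0 VC t0]) simp_all
    finally have "t * (2 * C * (exp (- t) * a)) \<le> t * (C * ?N + C\<^sup>2 * (approx_form m X t f f + ?F))"
      by (simp add: algebra_simps)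
    with t show ?thesis by simp
  qed
  have "2 * C * a \<le> C * ?N + C\<^sup>2 * (E + ?F)" if a: "a < ?M" for a
  proof -
    have "eventually (\<lambda>s. a < (LINT x|\<nu>. transition X s f x)) (at_right 0)"
      using transition_integral_tendsto_at_0[OF X \<nu> f(1-3)] a by (rule order_tendstoD(1))
    then obtain b where b: "0 < b" "\<And>s. 0 < s \<Longrightarrow> s < b \<Longrightarrow> a < (LINT x|\<nu>. transition X s f x)"
      unfolding eventually_at_right_field by auto
    have "eventually (\<lambda>t. 2 * C * (exp (- t) * a) \<le> C * ?N + C\<^sup>2 * (approx_form m X t f f + ?F)) (at_right 0)"
      unfolding eventually_at_right_field
    proof (intro exI[of _ b] conjI allI impI b(1))
      fix t :: real assume "0 < t" "t < b"
      then show "2 * C * (exp (- t) * a) \<le> C * ?N + C\<^sup>2 * (approx_form m X t f f + ?F)"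
        using b(2) by (intro main) (auto intro: less_imp_le)
    qed
    moreover have "((\<lambda>t. 2 * C * (exp (- t) * a)) \<longlongrightarrow> 2 * C * (exp (- 0) * a)) (at_right 0)"
      by (intro tendsto_intros)
    moreover have "((\<lambda>t. C * ?N + C\<^sup>2 * (approx_form m X t f f + ?F)) \<longlongrightarrow> C * ?N + C\<^sup>2 * (E + ?F)) (at_right 0)"
      by (intro tendsto_intros E)
    ultimately show ?thesis
      using tendsto_le[of "at_right (0::real)"] by fastforce
  qed
  then have "a \<le> (?N + C * (E + ?F)) / 2" if "a < ?M" for a
  proof -
    have "C * (2 * a) \<le> C * (?N + C * (E + ?F))"
      using \<open>\<And>a. a < ?M \<Longrightarrow> 2 * C * a \<le> C * ?N + C\<^sup>2 * (E + ?F)\<close>[OF that]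
      by (simp add: power2_eq_square algebra_simps)
    with C show ?thesis by simp
  qed
  then have "?M \<le> (?N + C * (E + ?F)) / 2"
    by (rule dense_le)
  then show ?thesis by simp
qed

section \<open>Cutoff functions, exhaustion by nests, and the Radon property\<close>

lemma locally_compact_euclideanE:
  assumes "locally_compact_space (euclidean :: 'a::topological_space topology)"
  obtains U K where "open U" "compact K" "(x::'a) \<in> U" "U \<subseteq> K"
proof -
  have "\<exists>U K. open U \<and> compact K \<and> x \<in> U \<and> U \<subseteq> K"
    using assms by (simp add: locally_compact_space_def)
  then show thesis using that by blast
qed

lemma radon_measure_sigma_finite:
  fixes m :: "'a::{metric_space, second_countable_topology} measure"
  assumes lc: "locally_compact_space (euclidean :: 'a topology)" and m: "radon_measure m"
  shows "sigma_finite_measure m"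
proof
  let ?\<U> = "{U :: 'a set. open U \<and> (\<exists>K. compact K \<and> U \<subseteq> K)}"
  obtain \<V> where \<V>: "\<V> \<subseteq> ?\<U>" "countable \<V>" "\<Union>\<V> = \<Union>?\<U>"
    by (rule Lindelof[of ?\<U>]) auto
  have "\<Union>?\<U> = UNIV"
  proof (intro equalityI subsetI)
    fix x :: 'a
    obtain U K where "open U" "compact K" "x \<in> U" "U \<subseteq> K"
      by (rule locally_compact_euclideanE[OF lc])
    then show "x \<in> \<Union>?\<U>" by auto
  qed simp
  moreover have "emeasure m U \<noteq> \<infinity>" if U: "U \<in> \<V>" for U
  proof -
    obtain K where K: "compact K" "U \<subseteq> K" using subsetD[OF \<V>(1) U] by auto
    have "emeasure m U \<le> emeasure m K"
      using K(2) borel_compact[OF K(1)] m by (intro emeasure_mono) (simp_all add: radon_measure_def)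
    also have "\<dots> < \<infinity>" using K(1) m by (simp add: radon_measure_def)
    finally show ?thesis by simp
  qed
  moreover have "\<V> \<subseteq> sets m"
    using \<V>(1) m by (auto simp: radon_measure_def)
  moreover have "space m = UNIV"
    using sets_eq_imp_space_eq[of m borel] m by (simp add: radon_measure_def)
  ultimately show "\<exists>A. countable A \<and> A \<subseteq> sets m \<and> \<Union>A = space m \<and> (\<forall>a\<in>A. emeasure m a \<noteq> \<infinity>)"
    using \<V> by (intro exI[of _ \<V>]) auto
qed

text \<open>
  The distance to the complement of a relatively compact neighbourhood \<open>W\<close> of \<open>K\<close>, divided by its
  minimum over \<open>K\<close>.
\<close>

lemma Cc_cutoff_exists:
  fixes K :: "'a::metric_space set"
  assumes lc: "locally_compact_space (euclidean :: 'a topology)" and K: "compact K"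
  obtains g where "g \<in> Cc" "\<And>x. x \<in> K \<Longrightarrow> g x \<ge> 1"
proof -
  let ?\<U> = "{U :: 'a set. open U \<and> (\<exists>L. compact L \<and> U \<subseteq> L)}"
  have "K \<subseteq> \<Union>?\<U>"
  proof
    fix x :: 'a
    obtain U L where "open U" "compact L" "x \<in> U" "U \<subseteq> L"
      by (rule locally_compact_euclideanE[OF lc])
    then show "x \<in> \<Union>?\<U>" by blast
  qed
  with K obtain \<V> where \<V>: "\<V> \<subseteq> ?\<U>" "finite \<V>" "K \<subseteq> \<Union>\<V>"
    by (rule compactE) auto
  have "\<forall>U\<in>\<V>. \<exists>L. compact L \<and> U \<subseteq> L" using \<V>(1) by blast
  then obtain L where L: "\<And>U. U \<in> \<V> \<Longrightarrow> compact (L U) \<and> U \<subseteq> L U" by metis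
  define W where "W = \<Union>\<V>"
  have W: "open W" "K \<subseteq> W" using \<V> by (auto simp: W_def)
  have L': "compact (\<Union>(L ` \<V>))" "W \<subseteq> \<Union>(L ` \<V>)"
    using L \<V>(2) by (auto simp: W_def intro!: compact_UN)
  consider "K = {}" | "W = UNIV" | "K \<noteq> {}" "W \<noteq> UNIV" by blast
  then show thesis
  proof cases
    case 1
    then show ?thesis by (intro that[of "\<lambda>_. 0"]) (auto simp: Cc_def)
  next
    case 2
    then have "\<Union>(L ` \<V>) = UNIV" using L'(2) by auto
    then show ?thesis using L'(1) by (intro that[of "\<lambda>_. 1"]) (auto simp: Cc_def)
  next
    case 3
    let ?d = "\<lambda>x. infdist x (- W)"
    have cont: "continuous_on S ?d" for S by (intro continuous_intros)
    obtain y where y: "y \<in> K" "\<And>x. x \<in> K \<Longrightarrow> ?d y \<le> ?d x"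
      using continuous_attains_inf[OF K 3(1) cont] by blast
    have d0: "?d x = 0 \<longleftrightarrow> x \<notin> W" for x
      using in_closed_iff_infdist_zero[of "- W" x] 3(2) W(1) by auto
    have pos: "0 < ?d y"
      using d0[of y] y(1) W(2) infdist_nonneg[of y "- W"] by (auto simp: less_le)
    show ?thesis
    proof (rule that[of "\<lambda>x. ?d x / ?d y"])
      have "{x. ?d x / ?d y \<noteq> 0} \<subseteq> \<Union>(L ` \<V>)"
        using d0 L'(2) by auto
      then have "closure {x. ?d x / ?d y \<noteq> 0} \<subseteq> \<Union>(L ` \<V>)"
        using compact_imp_closed[OF L'(1)] by (rule closure_minimal)
      then have "compact (closure {x. ?d x / ?d y \<noteq> 0})"
        using L'(1) by (metis closed_closure compact_Int_closed inf.absorb_iff2)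
      then show "(\<lambda>x. ?d x / ?d y) \<in> Cc"
        using pos by (auto simp: Cc_def intro!: continuous_intros)
      show "1 \<le> ?d x / ?d y" if "x \<in> K" for x
        using pos y(2)[OF that] by (simp add: le_divide_eq_1)
    qed
  qed
qed

text \<open>
  Uniform approximation within \<open>1/2\<close> of a cutoff function, then doubling and truncating to \<open>[0, 1]\<close>.
\<close>

lemma regular_form_cutoff_exists:
  fixes K :: "'a::metric_space set"
  assumes lc: "locally_compact_space (euclidean :: 'a topology)" and K: "compact K"
    and reg: "regular_dirichlet_form m \<E> \<F>"
  obtains f where "f \<in> \<F>" "continuous_on UNIV f" "\<And>x. 0 \<le> f x" "\<And>x. f x \<le> 1"
    "\<And>x. x \<in> K \<Longrightarrow> f x = 1"
proof -
  obtain g where g: "g \<in> Cc" "\<And>x. x \<in> K \<Longrightarrow> g x \<ge> 1"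
    by (rule Cc_cutoff_exists[OF lc K]) blast
  have "\<forall>f\<in>Cc. \<forall>\<epsilon>>0. \<exists>v\<in>\<F> \<inter> Cc. \<forall>x. \<bar>f x - v x\<bar> < \<epsilon>"
    and scale: "\<forall>u\<in>\<F>. \<forall>c. (\<lambda>x. c * u x) \<in> \<F>"
    and trunc: "\<forall>u\<in>\<F>. (\<lambda>x. min (max (u x) 0) 1) \<in> \<F>"
    using reg by (simp_all add: regular_dirichlet_form_def dirichlet_form_def symmetric_form_def)
  from this(1)[rule_format, OF g(1), of "1/2"]
  obtain v where v: "v \<in> \<F>" "v \<in> Cc" and d: "\<And>x. \<bar>g x - v x\<bar> < 1/2"
    by auto
  show thesis
  proof (rule that[of "\<lambda>x. min (max (2 * v x) 0) 1"])
    show "(\<lambda>x. min (max (2 * v x) 0) 1) \<in> \<F>"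
      by (rule trunc[rule_format, OF scale[rule_format, OF v(1)]])
    show "continuous_on UNIV (\<lambda>x. min (max (2 * v x) 0) 1)"
      using v(2) by (auto simp: Cc_def intro!: continuous_intros)
    show "min (max (2 * v x) 0) 1 = 1" if "x \<in> K" for x
      using d[of x] g(2)[OF that] by (auto simp: min_def max_def)
  qed (auto simp: min_def)
qed

lemma cap_mono: "A \<subseteq> B \<Longrightarrow> cap m \<E> \<F> A \<le> cap m \<E> \<F> B"
  unfolding cap_def by (rule INF_superset_mono) auto

text \<open>
  The part of \<open>K\<close> outside the nest has zero capacity, so it is not charged.
\<close>

lemma compact_nest_exhausts:
  fixes K :: "'a::t2_space set"
  assumes nest: "compact_nest m \<E> \<F> F" and K: "compact K"
    and sets: "sets \<mu> = sets borel"
    and null: "\<And>B. B \<in> sets borel \<Longrightarrow> cap m \<E> \<F> B = 0 \<Longrightarrow> emeasure \<mu> B = 0"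
  shows "emeasure \<mu> K = (SUP l. emeasure \<mu> (K \<inter> F l))"
proof -
  have F: "incseq F" "\<And>l. compact (F l)" and lim: "(\<lambda>l. cap m \<E> \<F> (K - F l)) \<longlonglongrightarrow> 0"
    using nest K by (auto simp: compact_nest_def)
  have [measurable]: "K \<in> sets \<mu>" "\<And>l. F l \<in> sets \<mu>"
    using K F(2) by (simp_all add: sets borel_compact)
  have "cap m \<E> \<F> (K - (\<Union>l. F l)) \<le> 0"
    using lim by (rule LIMSEQ_le_const) (auto intro!: exI[of _ 0] cap_mono)
  moreover have "K - (\<Union>l. F l) \<in> sets borel"
    unfolding sets[symmetric] by measurable
  ultimately have "emeasure \<mu> (K - (\<Union>l. F l)) = 0"
    using null by simp
  then have "AE x in \<mu>. x \<notin> K - (\<Union>l. F l)"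
    by (intro AE_not_in) (auto simp: null_sets_def)
  then have "emeasure \<mu> K = emeasure \<mu> (\<Union>l. K \<inter> F l)"
    by (intro emeasure_eq_AE) auto
  also have "\<dots> = (SUP l. emeasure \<mu> (K \<inter> F l))"
    using F(1) by (intro SUP_emeasure_incseq[symmetric]) (auto simp: incseq_def)
  finally show ?thesis .
qed

lemma in_LinfE:
  assumes "in_Linf m G"
  obtains C :: real where "0 < C" "AE x in m. G x \<le> ennreal C"
proof
  let ?s = "esssup (completion m) G"
  show "0 < enn2real ?s + 1" by (simp add: add_nonneg_pos)
  have "?s < top" using assms by (simp add: in_Linf_def)
  then have "?s \<le> ennreal (enn2real ?s + 1)"
    by (metis ennreal_enn2real ennreal_leI le_add_same_cancel1 zero_le_one)
  moreover have "AE x in completion m. G x \<le> ?s" by (rule esssup_AE)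
  ultimately have "AE x in completion m. G x \<le> ennreal (enn2real ?s + 1)"
    by (auto elim!: eventually_mono intro: order_trans)
  then show "AE x in m. G x \<le> ennreal (enn2real ?s + 1)"
    by (simp add: AE_completion_iff)
qed

theorem proposition3p2:
  fixes m \<mu> :: "'a::{metric_space, second_countable_topology} measure"
    and \<E> :: "('a \<Rightarrow> real) \<Rightarrow> ('a \<Rightarrow> real) \<Rightarrow> real" and \<F> :: "('a \<Rightarrow> real) set"
    and X :: "('w, 'a) process" and A :: "ennreal \<Rightarrow> 'w \<Rightarrow> ennreal"
    and F :: "nat \<Rightarrow> 'a set"
  assumes "locally_compact_space (euclidean :: 'a topology)"
    and "radon_measure m" and "full_support m"
    and "regular_dirichlet_form m \<E> \<F>"
    and "hunt_process X" and "associated m \<E> \<F> X"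
    and "\<mu> \<in> smooth_measures m \<E> \<F>"
    and "pcaf m \<E> \<F> X A" and "revuz_correspondence m X A \<mu>"
    and "\<And>\<alpha>. \<alpha> > 0 \<Longrightarrow> in_Linf m (af_potential X A \<alpha> (\<lambda>_. 1))"
    and "compact_nest m \<E> \<F> F"
    and "\<And>l. density \<mu> (indicator (F l)) \<in> S0_measures m \<E> \<F>"
  shows "radon_measure \<mu>"
proof -
  note lc = assms(1) and X = assms(5)
  have m: "sets m = sets borel" using assms(2) by (simp add: radon_measure_def)
  have \<mu>: "sets \<mu> = sets borel"
    and null: "\<And>B. B \<in> sets borel \<Longrightarrow> cap m \<E> \<F> B = 0 \<Longrightarrow> emeasure \<mu> B = 0"
    using assms(7) by (auto simp: smooth_measures_def)
  have sym: "symmetric_process m X" using assms(6) by (simp add: associated_def)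
  have sf: "sigma_finite_measure m" by (rule radon_measure_sigma_finite[OF lc assms(2)])
  obtain C where C: "0 < C" "AE x in m. af_potential X A 1 (\<lambda>_. 1) x \<le> ennreal C"
    using in_LinfE[OF assms(10)[of 1]] by auto
  have potential_le: "(\<integral>\<^sup>+x. resolvent X 1 h x \<partial>\<mu>) \<le> ennreal C * (\<integral>\<^sup>+x. h x \<partial>m)"
    if h: "h \<in> borel_measurable borel" for h
  proof -
    have "(\<integral>\<^sup>+x. 1 * resolvent X 1 h x \<partial>\<mu>) = (\<integral>\<^sup>+x. h x * af_potential X A 1 (\<lambda>_. 1) x \<partial>completion m)"
      by (rule assms(9)[unfolded revuz_correspondence_def, rule_format, symmetric, OF zero_less_one borel_measurable_const h])
    also have "\<dots> \<le> (\<integral>\<^sup>+x. ennreal C * h x \<partial>m)"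
      unfolding nn_integral_completion using C(2)
      by (intro nn_integral_mono_AE) (auto elim!: eventually_mono simp: mult.commute[of "h _"] intro: mult_right_mono)
    also have "\<dots> = ennreal C * (\<integral>\<^sup>+x. h x \<partial>m)"
      using h by (intro nn_integral_cmult) (simp add: measurable_cong_sets[OF m refl])
    finally show ?thesis by simp
  qed
  show ?thesis
    unfolding radon_measure_def
  proof (intro conjI allI impI \<mu>)
    fix K :: "'a set" assume K: "compact K"
    obtain f where f: "f \<in> \<F>" "continuous_on UNIV f" "\<And>x. 0 \<le> f x" "\<And>x. f x \<le> 1" "\<And>x. x \<in> K \<Longrightarrow> f x = 1"
      using regular_form_cutoff_exists[OF lc K assms(4)] by metis
    have f2: "integrable m (\<lambda>x. (f x)\<^sup>2)"
      using assms(6) f(1) by (auto simp: associated_def L2_def)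
    have lim: "((\<lambda>t. approx_form m X t f f) \<longlongrightarrow> \<E> f f) (at_right 0)"
      using assms(6) f(1) by (auto simp: associated_def)
    have "emeasure \<mu> (K \<inter> F l) \<le> ennreal (C * (\<E> f f + (LINT x|m. (f x)\<^sup>2)))" for l
    proof -
      have Fl: "compact (F l)" using assms(11) by (simp add: compact_nest_def)
      have S: "K \<inter> F l \<in> sets \<mu>" "F l \<in> sets \<mu>"
        using K Fl by (simp_all add: \<mu> borel_compact sets.Int)
      define \<nu> where "\<nu> = density \<mu> (indicator (K \<inter> F l))"
      have \<nu>s: "sets \<nu> = sets borel" by (simp add: \<nu>_def \<mu>)
      have sp: "space \<nu> = UNIV" using sets_eq_imp_space_eq[OF \<nu>s] by simp
      have \<nu>U: "emeasure \<nu> UNIV = emeasure \<mu> (K \<inter> F l)"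
      proof -
        have "UNIV \<in> sets \<mu>" by (simp add: \<mu>)
        with S(1) show ?thesis by (simp add: \<nu>_def emeasure_density)
      qed
      have "emeasure \<mu> (K \<inter> F l) \<le> emeasure \<mu> (F l)"
        using S by (intro emeasure_mono) auto
      also have "\<dots> = emeasure (density \<mu> (indicator (F l))) (F l)"
        using S(2) by (simp add: emeasure_density indicator_inter_arith[symmetric])
      also have "\<dots> < \<infinity>"
        using assms(12)[of l] Fl by (auto simp: S0_measures_def radon_measure_def)
      finally have fin: "finite_measure \<nu>"
        by (intro finite_measureI) (simp add: sp \<nu>U)
      interpret finite_measure \<nu> by fact
      have "2 * (LINT x|\<nu>. f x) \<le> measure \<nu> UNIV + C * (\<E> f f + (LINT x|m. (f x)\<^sup>2))"
      proof (rule bounded_potential_energy_inequality[OF X sym fin \<nu>s sf m C(1) _ f(2-4) f2 lim])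
        fix h :: "'a \<Rightarrow> ennreal" assume h: "h \<in> borel_measurable borel"
        have "resolvent X 1 h \<in> borel_measurable \<mu>"
          using resolvent_measurable[OF X h] by (simp add: measurable_cong_sets[OF \<mu> refl])
        then have "(\<integral>\<^sup>+x. resolvent X 1 h x \<partial>\<nu>) = (\<integral>\<^sup>+x. indicator (K \<inter> F l) x * resolvent X 1 h x \<partial>\<mu>)"
          using S unfolding \<nu>_def by (intro nn_integral_density) auto
        also have "\<dots> \<le> (\<integral>\<^sup>+x. resolvent X 1 h x \<partial>\<mu>)"
          by (intro nn_integral_mono) (auto simp: indicator_def)
        also have "\<dots> \<le> ennreal C * (\<integral>\<^sup>+x. h x \<partial>m)" by (rule potential_le[OF h])
        finally show "(\<integral>\<^sup>+x. resolvent X 1 h x \<partial>\<nu>) \<le> ennreal C * (\<integral>\<^sup>+x. h x \<partial>m)" .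
      qed
      moreover have "(LINT x|\<nu>. f x) = (LINT x|\<nu>. 1)"
      proof (rule integral_cong_AE)
        show "f \<in> borel_measurable \<nu>"
          using borel_measurable_continuous_onI[OF f(2)] by (simp add: measurable_cong_sets[OF \<nu>s refl])
        show "AE x in \<nu>. f x = 1"
          unfolding \<nu>_def using S(1) f(5) by (subst AE_density) (auto simp: indicator_def)
      qed simp
      ultimately have "measure \<nu> UNIV \<le> C * (\<E> f f + (LINT x|m. (f x)\<^sup>2))"
        by (simp add: sp)
      then show ?thesis
        unfolding \<nu>U[symmetric] emeasure_eq_measure by (rule ennreal_leI)
    qed
    moreover have "emeasure \<mu> K = (SUP l. emeasure \<mu> (K \<inter> F l))"
      by (rule compact_nest_exhausts[OF assms(11) K \<mu>]) (rule null)
    ultimately have "emeasure \<mu> K \<le> ennreal (C * (\<E> f f + (LINT x|m. (f x)\<^sup>2)))"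
      by (simp add: SUP_least)
    then show "emeasure \<mu> K < \<infinity>"
      by (rule le_less_trans) simp
  qed
qed

end
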